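(* Consider the vehicle chain $s^2x_i(s)=u_i(s)+d_i(s)$, $i=0,1,\dots,N$, with configuration errors $e_i(s)=x_{i-1}(s)-x_i(s)-hs\,x_i(s)$, $i=1,\dots,N$, and controllers $u_0=0$ and $u_i(s)=K(s)e_i(s)$ for $i=1,\dots,N$ (exact measurement of the configuration error, no communication). A stabilizing PID controller with sufficient headway can ensure $(L_2,l_2)$ string stability; that is, there exist a stabilizing PID controller $K(s)=k_P+k_I/s+k_D s$ (with $k_I\neq 0$) and a time-headway $h>0$ satisfying $$h>\max_{\omega}\left(\sqrt{K_R(j\omega)\left(2-\omega^2K_R(j\omega)\right)}+\omega K_J(j\omega)\right),$$ where $$K_R(j\omega)=\tfrac12\Big(\tfrac{1}{K(j\omega)}+\tfrac{1}{K(j\omega)^*}\Big),\qquad K_J(j\omega)=\tfrac1{2j}\Big(\tfrac{1}{K(j\omega)}-\tfrac{1}{K(j\omega)^*}\Big)$$ and the maximization runs over all $\omega$ for which the argument of the square root is positive, such that the chain is $(L_2,l_2)$ string stable.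
   Context: Signals are described in the Laplace domain ($s$ is the Laplace variable, $s=j\omega$ on the imaginary axis, $^*$ denotes complex conjugation); the system is causal and starts at rest, initial conditions being modeled through the disturbances. $x_i$ is the configuration of vehicle $i$ (deviation from nominal position), $u_i$ its control input, $d_i$ a disturbance input; vehicle $0$ is the leader. $K$ and $h$ do not depend on $N$ and are the same for all vehicles. "Stabilizing" means that the closed-loop system is stable (the closed-loop characteristic polynomial, i.e. the numerator $s^3+s(1+hs)K(s)$ of $s^2+(1+hs)K(s)$ for a PID controller, has its zeros in the open left half plane). For a scalar signal, $\Vert v_i(\cdot)\Vert_2=\big(\int_{-\infty}^{+\infty}v_i(t)^2\,dt\big)^{1/2}$; for a vector $v$ of signals $v_i$, the $(L_2,l_2)$ norm is $\Vert v(\cdot)\Vert_2=\big(\sum_i\int_{-\infty}^{+\infty}v_i(t)^2\,dt\big)^{1/2}$, summing over all components, with $e=(e_1,\dots,e_N)$ and $d=(d_0,\dots,d_N)$. $(L_2,l_2)$ string stability: there exists a constant $c_1$ such that $\Vert e(\cdot)\Vert_2\le c_1\Vert d(\cdot)\Vert_2$ for all disturbances $d$ of bounded norm and all chain lengths $N$. *)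

theory Defs
  imports "HOL-Analysis.Analysis" "HOL-Computational_Algebra.Polynomial"
begin

text \<open>Signals are real functions of time. The system is causal and starts at rest at time 0,
  so every signal vanishes on the negative half-line and the unilateral Laplace transform
  below describes it completely (up to null sets).\<close>

definition signal :: "(real \<Rightarrow> real) \<Rightarrow> bool" where
  "signal f \<longleftrightarrow> f \<in> borel_measurable borel \<and> (\<forall>t<0. f t = 0)"

definition laplace_converges :: "(real \<Rightarrow> real) \<Rightarrow> complex \<Rightarrow> bool" where
  "laplace_converges f s \<longleftrightarrow>
     set_integrable lborel {0..} (\<lambda>t. exp (- (s * complex_of_real t)) * complex_of_real (f t))"

definition laplace :: "(real \<Rightarrow> real) \<Rightarrow> complex \<Rightarrow> complex" where
  "laplace f s = (LINT t:{0..}|lborel. exp (- (s * complex_of_real t)) * complex_of_real (f t))"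

definition finite_L2 :: "(real \<Rightarrow> real) \<Rightarrow> bool" where
  "finite_L2 f \<longleftrightarrow> integrable lborel (\<lambda>t. (f t)\<^sup>2)"

text \<open>Meaningful only if all components indexed by \<open>I\<close> satisfy \<^const>\<open>finite_L2\<close>,
  since the Bochner integral of a non-integrable function is 0.\<close>

definition L2_l2_norm :: "nat set \<Rightarrow> (nat \<Rightarrow> real \<Rightarrow> real) \<Rightarrow> real" where
  "L2_l2_norm I v = sqrt (\<Sum>i\<in>I. LINT t|lborel. (v i t)\<^sup>2)"


text \<open>The value at the pole 0 is a junk value; no definition below uses it.\<close>

definition pid :: "real \<Rightarrow> real \<Rightarrow> real \<Rightarrow> complex \<Rightarrow> complex" where
  "pid kP kI kD s = of_real kP + of_real kI / s + of_real kD * s"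

text \<open>The polynomial \<open>s\<^sup>3 + s (1 + h s) K(s)\<close>, with the pole of \<open>K\<close> at 0 cancelled by
  the factor \<open>s\<close>.\<close>

definition pid_char_poly :: "real \<Rightarrow> real \<Rightarrow> real \<Rightarrow> real \<Rightarrow> complex poly" where
  "pid_char_poly kP kI kD h =
     monom 1 3 + [:1, of_real h:] * [:of_real kI, of_real kP, of_real kD:]"

lemma poly_pid_char_poly:
  assumes "s \<noteq> 0"
  shows "poly (pid_char_poly kP kI kD h) s = s ^ 3 + s * (1 + of_real h * s) * pid kP kI kD s"
  using assms
  by (simp add: pid_char_poly_def pid_def poly_monom field_simps)

definition stabilizing_pid :: "real \<Rightarrow> real \<Rightarrow> real \<Rightarrow> real \<Rightarrow> bool" where
  "stabilizing_pid kP kI kD h \<longleftrightarrow> (\<forall>s. poly (pid_char_poly kP kI kD h) s = 0 \<longrightarrow> Re s < 0)"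


text \<open>The complex expressions inside \<^const>\<open>Re\<close> are real: they are the real and imaginary part
  of \<open>1 / K(j\<omega>)\<close>.\<close>

definition K_R :: "(complex \<Rightarrow> complex) \<Rightarrow> real \<Rightarrow> real" where
  "K_R K \<omega> = Re (1 / 2 * (1 / K (\<i> * of_real \<omega>) + 1 / cnj (K (\<i> * of_real \<omega>))))"

definition K_J :: "(complex \<Rightarrow> complex) \<Rightarrow> real \<Rightarrow> real" where
  "K_J K \<omega> = Re (1 / (2 * \<i>) * (1 / K (\<i> * of_real \<omega>) - 1 / cnj (K (\<i> * of_real \<omega>))))"

definition sqrt_arg :: "(complex \<Rightarrow> complex) \<Rightarrow> real \<Rightarrow> real" where
  "sqrt_arg K \<omega> = K_R K \<omega> * (2 - \<omega>\<^sup>2 * K_R K \<omega>)"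

text \<open>Frequency 0 is excluded explicitly: a controller with integral action has a pole there, so
  that \<open>1 / K(0) = 0\<close> and the argument of the square root is 0, whereas the totalised
  \<^const>\<open>pid\<close> has a spurious finite value at 0. Likewise \<open>1 / K(j\<omega>)\<close> must be defined.\<close>

definition headway_freqs :: "(complex \<Rightarrow> complex) \<Rightarrow> real set" where
  "headway_freqs K = {\<omega>. \<omega> \<noteq> 0 \<and> K (\<i> * of_real \<omega>) \<noteq> 0 \<and> sqrt_arg K \<omega> > 0}"

definition headway_bound :: "(complex \<Rightarrow> complex) \<Rightarrow> real \<Rightarrow> real" where
  "headway_bound K \<omega> = sqrt (sqrt_arg K \<omega>) + \<omega> * K_J K \<omega>"

text \<open>The maximum exists (is attained) and is smaller than \<open>h\<close>.\<close>

definition sufficient_headway :: "(complex \<Rightarrow> complex) \<Rightarrow> real \<Rightarrow> bool" where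
  "sufficient_headway K h \<longleftrightarrow>
     (\<exists>\<omega>. is_arg_max (headway_bound K) (\<lambda>\<omega>. \<omega> \<in> headway_freqs K) \<omega> \<and> h > headway_bound K \<omega>)"


text \<open>Closed-loop equations in the Laplace domain for vehicles \<open>0, \<dots>, N\<close>. They are imposed on some
  right half-plane where all transforms converge; its abscissa is not prescribed, so exponentially
  growing responses are not ruled out. The requirement \<open>\<sigma> \<ge> 0\<close> avoids the pole of a PID
  controller.\<close>

definition chain_response ::
  "(complex \<Rightarrow> complex) \<Rightarrow> real \<Rightarrow> nat \<Rightarrow> (nat \<Rightarrow> real \<Rightarrow> real) \<Rightarrow>
   (nat \<Rightarrow> real \<Rightarrow> real) \<Rightarrow> (nat \<Rightarrow> real \<Rightarrow> real) \<Rightarrow> (nat \<Rightarrow> real \<Rightarrow> real) \<Rightarrow> bool" where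
  "chain_response K h N d x u e \<longleftrightarrow>
     (\<forall>i\<in>{0..N}. signal (x i) \<and> signal (u i)) \<and> (\<forall>i\<in>{1..N}. signal (e i)) \<and>
     (\<exists>\<sigma>\<ge>0. \<forall>s. Re s > \<sigma> \<longrightarrow>
        (\<forall>i\<in>{0..N}. laplace_converges (d i) s \<and> laplace_converges (x i) s \<and>
                    laplace_converges (u i) s) \<and>
        (\<forall>i\<in>{1..N}. laplace_converges (e i) s) \<and>
        (\<forall>i\<in>{0..N}. s\<^sup>2 * laplace (x i) s = laplace (u i) s + laplace (d i) s) \<and>
        (\<forall>i\<in>{1..N}. laplace (e i) s =
           laplace (x (i - 1)) s - laplace (x i) s - of_real h * s * laplace (x i) s) \<and>
        laplace (u 0) s = 0 \<and>
        (\<forall>i\<in>{1..N}. laplace (u i) s = K s * laplace (e i) s))"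

text \<open>The bound is required of every response. Responses are also required to exist, so that the
  bound cannot hold vacuously; the gain \<open>c1\<close> is chosen before the chain length \<open>N\<close>.\<close>

definition L2_l2_string_stable :: "(complex \<Rightarrow> complex) \<Rightarrow> real \<Rightarrow> bool" where
  "L2_l2_string_stable K h \<longleftrightarrow>
     (\<exists>c1::real. \<forall>N d. (\<forall>i\<in>{0..N}. signal (d i) \<and> finite_L2 (d i)) \<longrightarrow>
        (\<exists>x u e. chain_response K h N d x u e) \<and>
        (\<forall>x u e. chain_response K h N d x u e \<longrightarrow>
           (\<forall>i\<in>{1..N}. finite_L2 (e i)) \<and>
           L2_l2_norm {1..N} e \<le> c1 * L2_l2_norm {0..N} d))"

end

theory Submission
  imports Defs "HOL-Probability.Levy"
begin

text \<open>Take \<open>K(s) = 3/4 + 1/(4 s)\<close> and \<open>h = 3\<close>; the characteristic polynomial is then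
  \<open>(s + 1)\<^sup>2 (s + 1/4)\<close>. In the accelerations \<open>f\<^sub>i = u\<^sub>i + d\<^sub>i\<close> the chain reads
  \<open>f\<^sub>i = \<Gamma> f\<^sub>i\<^sub>-\<^sub>1 + S d\<^sub>i\<close> with \<open>\<Gamma> = K / (s\<^sup>2 + (1 + h s) K)\<close>, \<open>\<bar>\<Gamma>(j\<omega>)\<bar> \<le> 1\<close> and
  \<open>S = s\<^sup>2 / (s\<^sup>2 + (1 + h s) K)\<close>. Instead of Parseval's identity the estimate uses a quadratic storage
  function \<open>V\<^sub>i \<ge> 0\<close> of the loop state of vehicle \<open>i\<close> with
  \<open>V\<^sub>i' \<le> f\<^sub>i\<^sub>-\<^sub>1\<^sup>2 - f\<^sub>i\<^sup>2 - 3/16 e\<^sub>i\<^sup>2 + 14 d\<^sub>i\<^sup>2\<close>: integrated over \<open>[0, T]\<close> and summed over \<open>i\<close> the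
  accelerations telescope, leaving a bound on \<open>e\<close> by \<open>d\<close> that is independent of \<open>N\<close> and \<open>T\<close>. This
  bounds one response; every other response has the same Laplace transforms, hence agrees with it
  almost everywhere by Lerch's theorem, which is reduced to the uniqueness theorem for
  characteristic functions.\<close>

section \<open>Uniqueness of Laplace transforms\<close>

text \<open>The positive and negative parts of \<open>f\<close> have equal Fourier transforms, in
  particular equal mass \<open>m\<close>. Divided by \<open>m\<close> they become probability
  densities with the same characteristic function, so Levy's uniqueness theorem identifies the two
  measures, and densities are unique almost everywhere.\<close>

lemma fourier_eq_0_imp_AE_0:
  fixes f :: "real \<Rightarrow> real"
  assumes f: "integrable lborel f"
    and eq: "\<And>t. (LINT x|lborel. iexp (t * x) * complex_of_real (f x)) = 0"
  shows "AE x in lborel. f x = 0"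
proof -
  define p where "p x = max (f x) 0" for x
  define q where "q x = max (- f x) 0" for x
  have pq: "f x = p x - q x" "p x \<ge> 0" "q x \<ge> 0" for x
    by (auto simp: p_def q_def)
  have int: "integrable lborel p" "integrable lborel q"
    using f unfolding p_def q_def by auto
  note [measurable] = borel_measurable_integrable[OF int(1)] borel_measurable_integrable[OF int(2)]
  define m where "m = (LINT x|lborel. p x)"
  have int_e: "integrable lborel (\<lambda>x. iexp (t * x) * complex_of_real (g x))"
    if g: "integrable lborel g" for g :: "real \<Rightarrow> real" and t
  proof (rule Bochner_Integration.integrable_bound[OF g])
    show "(\<lambda>x. iexp (t * x) * complex_of_real (g x)) \<in> borel_measurable lborel"
      using borel_measurable_integrable[OF g] by measurable
  qed (simp add: norm_mult)
  have char_eq: "(LINT x|lborel. iexp (t * x) * complex_of_real (p x)) =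
      (LINT x|lborel. iexp (t * x) * complex_of_real (q x))" for t
    using eq[of t] int_e[OF int(1), of t] int_e[OF int(2), of t]
    by (simp add: pq(1) right_diff_distrib)
  have m_q: "m = (LINT x|lborel. q x)"
  proof -
    have "complex_of_real m = complex_of_real (LINT x|lborel. q x)"
      using char_eq[of 0] by (simp add: m_def)
    then show ?thesis
      by (simp only: of_real_eq_iff)
  qed
  show ?thesis
  \<comment> \<open>Normalisation needs \<open>m > 0\<close>; mass 0 forces both nonnegative parts
    to vanish almost everywhere.\<close>
  proof (cases "m = 0")
    case True
    have "AE x in lborel. p x = 0" "AE x in lborel. q x = 0"
      using True m_q int pq integral_nonneg_eq_0_iff_AE[of lborel p]
        integral_nonneg_eq_0_iff_AE[of lborel q] by (simp_all add: m_def)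
    then show ?thesis
      by eventually_elim (simp add: pq)
  next
    case False
    then have m: "m > 0"
      using integral_nonneg_AE[of p lborel] pq by (simp add: m_def less_le)
    define D where "D g = density lborel (\<lambda>x. ennreal (g x / m))" for g :: "real \<Rightarrow> real"
    have D: "real_distribution (D g)"
      "char (D g) t = (LINT x|lborel. iexp (t * x) * complex_of_real (g x)) / m"
      if g: "integrable lborel g" "\<And>x. g x \<ge> 0" "(LINT x|lborel. g x) = m" for g t
    proof -
      have [measurable]: "g \<in> borel_measurable borel"
        using g(1) by auto
      have "emeasure (D g) (space (D g)) = (\<integral>\<^sup>+x. ennreal (g x / m) \<partial>lborel)"
        by (simp add: D_def emeasure_density)
      also have "\<dots> = ennreal (LINT x|lborel. g x / m)"
        using g m by (intro nn_integral_eq_integral) auto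
      also have "\<dots> = 1"
        using g m by simp
      finally have "prob_space (D g)"
        by (rule prob_spaceI)
      then show "real_distribution (D g)"
        by (simp add: real_distribution_def real_distribution_axioms_def D_def)
      have "char (D g) t = (LINT x|lborel. (g x / m) *\<^sub>R iexp (t * x))"
        unfolding char_def D_def using g(2) m
        by (intro integral_density) auto
      also have "\<dots> = (LINT x|lborel. iexp (t * x) * complex_of_real (g x) / complex_of_real m)"
        by (intro Bochner_Integration.integral_cong) (auto simp: scaleR_conv_of_real)
      finally show "char (D g) t = (LINT x|lborel. iexp (t * x) * complex_of_real (g x)) / m"
        by simp
    qed
    have "D p = D q"
      using D[OF int(1)] D[OF int(2)] pq(2,3) m_q char_eq
      by (intro Levy_uniqueness ext) (simp_all add: m_def)
    then have "AE x in lborel. ennreal (p x / m) = ennreal (q x / m)"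
      unfolding D_def by (subst (asm) sigma_finite_measure.density_unique_iff[OF lborel.sigma_finite_measure_axioms]) auto
    then show ?thesis
      by eventually_elim (use m pq in \<open>simp add: ennreal_inj\<close>)
  qed
qed

text \<open>On a single vertical line \<open>Re s = c\<close> inside the half-plane, the Laplace
  transform of \<open>f - g\<close> is the Fourier transform of the damped difference
  \<open>\<phi>\<close>, which therefore vanishes almost everywhere. Negative times are covered by
  \<open>signal\<close>.\<close>

lemma laplace_unique:
  assumes sig: "signal f" "signal g"
    and conv: "\<And>s. Re s > \<sigma> \<Longrightarrow> laplace_converges f s"
      "\<And>s. Re s > \<sigma> \<Longrightarrow> laplace_converges g s"
    and eq: "\<And>s. Re s > \<sigma> \<Longrightarrow> laplace f s = laplace g s"
  shows "AE t in lborel. f t = g t"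
proof -
  define c where "c = \<sigma> + 1"
  define \<phi> where "\<phi> t = indicator {0..} t * (exp (- (c * t)) * (f t - g t))" for t :: real
  have int: "integrable lborel (\<lambda>t. iexp (w * t) * complex_of_real (\<phi> t))"
    and zero: "(LINT t|lborel. iexp (w * t) * complex_of_real (\<phi> t)) = 0" for w
  proof -
    \<comment> \<open>The Laplace kernel has exponent \<open>- s t\<close> and the characteristic
      function has \<open>+ i w t\<close>, hence the sign of the imaginary part.\<close>
    define s where "s = Complex c (- w)"
    have s: "Re s > \<sigma>"
      by (simp add: s_def c_def)
    have *: "iexp (w * t) * complex_of_real (\<phi> t) =
        indicator {0..} t *\<^sub>R (exp (- (s * complex_of_real t)) * complex_of_real (f t)) -
        indicator {0..} t *\<^sub>R (exp (- (s * complex_of_real t)) * complex_of_real (g t))" for t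
    proof -
      have "- (s * complex_of_real t) = \<i> * complex_of_real (w * t) + complex_of_real (- (c * t))"
        by (simp add: s_def complex_eq_iff)
      then have "exp (- (s * complex_of_real t)) = iexp (w * t) * complex_of_real (exp (- (c * t)))"
        by (simp only: exp_add exp_of_real)
      then show ?thesis
        by (simp add: \<phi>_def indicator_def algebra_simps)
    qed
    show "integrable lborel (\<lambda>t. iexp (w * t) * complex_of_real (\<phi> t))"
      using conv[OF s] unfolding * laplace_converges_def set_integrable_def by auto
    show "(LINT t|lborel. iexp (w * t) * complex_of_real (\<phi> t)) = 0"
      using conv[OF s] eq[OF s]
      unfolding * laplace_converges_def set_integrable_def laplace_def set_lebesgue_integral_def
      by (subst Bochner_Integration.integral_diff) auto
  qed
  have "integrable lborel (\<lambda>t. complex_of_real (\<phi> t))"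
    using int[of 0] by simp
  then have "AE t in lborel. \<phi> t = 0"
    by (intro fourier_eq_0_imp_AE_0 zero) (simp add: complex_of_real_integrable_eq)
  then show ?thesis
  proof eventually_elim
    case (elim t)
    then show ?case
      using sig by (cases "t < 0") (auto simp: \<phi>_def signal_def)
  qed
qed

section \<open>Running integrals\<close>

text \<open>For \<open>t < 0\<close> the interval is empty and the value is 0, so running integrals
  again start at rest. The codomain is general because complex kernels \<open>exp (- s t)\<close>
  are integrated as well.\<close>

definition running_integral :: "(real \<Rightarrow> 'a::{banach, second_countable_topology}) \<Rightarrow> real \<Rightarrow> 'a" where
  "running_integral g t = (LINT \<tau>:{0..t}|lborel. g \<tau>)"

text \<open>Fubini over the square \<open>[0,T] \<times> [0,T]\<close>, cut along its diagonal.\<close>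

lemma running_integral_mult:
  fixes a b :: "real \<Rightarrow> 'a::{banach, real_normed_field, second_countable_topology}"
  assumes a: "set_integrable lborel {0..T} a" and b: "set_integrable lborel {0..T} b"
  shows "set_integrable lborel {0..T} (\<lambda>t. a t * running_integral b t)"
    and "set_integrable lborel {0..T} (\<lambda>t. running_integral a t * b t)"
    and "running_integral a T * running_integral b T =
      running_integral (\<lambda>t. a t * running_integral b t) T +
      running_integral (\<lambda>t. running_integral a t * b t) T"
proof -
  define A where "A t = indicator {0..T} t *\<^sub>R a t" for t
  define B where "B t = indicator {0..T} t *\<^sub>R b t" for t
  have int: "integrable lborel A" "integrable lborel B"
    using a b by (auto simp: A_def[abs_def] B_def[abs_def] set_integrable_def)
  note [measurable] = borel_measurable_integrable[OF int(1)] borel_measurable_integrable[OF int(2)]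
  have tri: "integrable (lborel \<Otimes>\<^sub>M lborel) (\<lambda>(s, t). A s * B t)"
  proof (rule lborel_pair.Fubini_integrable)
    show "(\<lambda>(s, t). A s * B t) \<in> borel_measurable (lborel \<Otimes>\<^sub>M lborel)"
      by measurable
    show "integrable lborel (\<lambda>s. LINT t|lborel. norm (case (s, t) of (s, t) \<Rightarrow> A s * B t))"
      using int by (simp add: norm_mult)
    show "AE s in lborel. integrable lborel (\<lambda>t. case (s, t) of (s, t) \<Rightarrow> A s * B t)"
      using int by simp
  qed
  define L where "L z = indicator {z. snd z \<le> fst z} z *\<^sub>R (case z of (s, t) \<Rightarrow> A s * B t)" for z
  define U where "U z = indicator {z. fst z < snd z} z *\<^sub>R (case z of (s, t) \<Rightarrow> A s * B t)" for z
  have "{z :: real \<times> real. snd z \<le> fst z} \<in> sets (lborel \<Otimes>\<^sub>M lborel)"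
    "{z :: real \<times> real. fst z < snd z} \<in> sets (lborel \<Otimes>\<^sub>M lborel)"
    unfolding lborel_prod sets_lborel
    by (intro borel_closed closed_Collect_le borel_open open_Collect_less continuous_intros)+
  have L: "integrable (lborel \<Otimes>\<^sub>M lborel) L"
    unfolding L_def[abs_def] by (rule integrable_mult_indicator[OF _ tri]) fact
  have U: "integrable (lborel \<Otimes>\<^sub>M lborel) U"
    unfolding U_def[abs_def] by (rule integrable_mult_indicator[OF _ tri]) fact
  have innerL: "(LINT t|lborel. L (s, t)) = indicator {0..T} s *\<^sub>R (a s * running_integral b s)" for s
  proof (cases "s \<in> {0..T}")
    case True
    have "(LINT t|lborel. L (s, t)) = (LINT t|lborel. a s * (indicator {0..s} t *\<^sub>R b t))"
      using True by (intro Bochner_Integration.integral_cong)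
        (auto simp: L_def A_def B_def indicator_def)
    also have "\<dots> = a s * running_integral b s"
      by (simp only: running_integral_def set_lebesgue_integral_def integral_mult_right_zero)
    finally show ?thesis
      using True by simp
  qed (simp add: L_def A_def)
  have innerU: "(LINT s|lborel. U (s, t)) = indicator {0..T} t *\<^sub>R (running_integral a t * b t)" for t
  proof (cases "t \<in> {0..T}")
    case True
    have "(LINT s|lborel. U (s, t)) = (LINT s|lborel. (indicator {0..t} s *\<^sub>R a s) * b t)"
    \<comment> \<open>The diagonal belongs to the lower triangle only, so that the two triangles
      partition the square; replacing the half-open section by \<open>{0..t}\<close> changes the
      integrand at the single point \<open>s = t\<close>.\<close>
    proof (rule integral_discrete_difference[where X = "{t}"])
      show "U (s, t) = (indicator {0..t} s *\<^sub>R a s) * b t" if "s \<notin> {t}" for s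
        using True that by (auto simp: U_def A_def B_def indicator_def)
    qed auto
    also have "\<dots> = running_integral a t * b t"
      by (simp only: running_integral_def set_lebesgue_integral_def integral_mult_left_zero)
    finally show ?thesis
      using True by simp
  qed (simp add: U_def B_def)
  have U': "integrable (lborel \<Otimes>\<^sub>M lborel) (\<lambda>(t, s). U (s, t))"
    using lborel_pair.integrable_product_swap[OF U] by simp
  show 1: "set_integrable lborel {0..T} (\<lambda>t. a t * running_integral b t)"
    using lborel_pair.integrable_fst'[OF L] unfolding innerL set_integrable_def .
  show 2: "set_integrable lborel {0..T} (\<lambda>t. running_integral a t * b t)"
    using lborel_pair.integrable_fst'[OF U'] by (simp add: innerU set_integrable_def)
  have "running_integral a T * running_integral b T = (LINT s|lborel. LINT t|lborel. A s * B t)"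
    by (simp only: running_integral_def set_lebesgue_integral_def A_def[symmetric] B_def[symmetric]
      integral_mult_right_zero integral_mult_left_zero)
  also have "\<dots> = integral\<^sup>L (lborel \<Otimes>\<^sub>M lborel) (\<lambda>(s, t). A s * B t)"
    using lborel_pair.integral_fst'[OF tri] by simp
  also have "(\<lambda>(s, t). A s * B t) = (\<lambda>z. L z + U z)"
    by (auto simp: L_def U_def indicator_def)
  also have "integral\<^sup>L (lborel \<Otimes>\<^sub>M lborel) (\<lambda>z. L z + U z) =
      integral\<^sup>L (lborel \<Otimes>\<^sub>M lborel) L + integral\<^sup>L (lborel \<Otimes>\<^sub>M lborel) U"
    using L U by (rule Bochner_Integration.integral_add)
  also have "integral\<^sup>L (lborel \<Otimes>\<^sub>M lborel) L = running_integral (\<lambda>t. a t * running_integral b t) T"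
    unfolding lborel_pair.integral_fst'[OF L, symmetric] innerL
    by (simp add: running_integral_def set_lebesgue_integral_def)
  also have "integral\<^sup>L (lborel \<Otimes>\<^sub>M lborel) U = integral\<^sup>L (lborel \<Otimes>\<^sub>M lborel) (\<lambda>(t, s). U (s, t))"
    using lborel_pair.integral_product_swap[of U] U by (simp add: case_prod_unfold)
  also have "\<dots> = running_integral (\<lambda>t. running_integral a t * b t) T"
    using lborel_pair.integral_fst'[OF U'] by (simp add: innerU running_integral_def set_lebesgue_integral_def)
  finally show "running_integral a T * running_integral b T =
      running_integral (\<lambda>t. a t * running_integral b t) T +
      running_integral (\<lambda>t. running_integral a t * b t) T" .
qed

section \<open>Exponentially weighted square-integrable signals\<close>

text \<open>A class that contains the square-integrable signals (weight 0) and is closed under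
  integration and under multiplication by exponentials. Positions, being double integrals, need not
  have finite energy, but in this class their transforms converge on some right half-plane.\<close>

definition exp_L2 :: "(real \<Rightarrow> real) \<Rightarrow> bool" where
  "exp_L2 g \<longleftrightarrow> signal g \<and> (\<exists>\<sigma>\<ge>0. integrable lborel (\<lambda>t. exp (- (\<sigma> * t)) * (g t)\<^sup>2))"

lemma exp_L2_measurable [measurable_dest]: "exp_L2 g \<Longrightarrow> g \<in> borel_measurable borel"
  by (simp add: exp_L2_def signal_def)

lemma exp_L2_nonneg_time: "exp_L2 g \<Longrightarrow> t < 0 \<Longrightarrow> g t = 0"
  by (simp add: exp_L2_def signal_def)

lemma exp_L2_signal: "exp_L2 g \<Longrightarrow> signal g"
  by (simp add: exp_L2_def)

lemma exp_L2_weight_mono: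
  assumes g: "exp_L2 g" and int: "integrable lborel (\<lambda>t. exp (- (\<sigma> * t)) * (g t)\<^sup>2)"
    and "\<sigma> \<le> \<rho>"
  shows "integrable lborel (\<lambda>t. exp (- (\<rho> * t)) * (g t)\<^sup>2)"
proof (rule Bochner_Integration.integrable_bound[OF int])
  note [measurable] = exp_L2_measurable[OF g]
  show "(\<lambda>t. exp (- (\<rho> * t)) * (g t)\<^sup>2) \<in> borel_measurable lborel"
    by measurable
  have "exp (- (\<rho> * t)) * (g t)\<^sup>2 \<le> exp (- (\<sigma> * t)) * (g t)\<^sup>2" for t
    using exp_L2_nonneg_time[OF g, of t] \<open>\<sigma> \<le> \<rho>\<close>
    by (cases "t < 0") (auto intro!: mult_right_mono)
  then show "AE t in lborel. norm (exp (- (\<rho> * t)) * (g t)\<^sup>2) \<le> norm (exp (- (\<sigma> * t)) * (g t)\<^sup>2)"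
    by simp
qed

lemma exp_L2_add:
  assumes "exp_L2 f" "exp_L2 g"
  shows "exp_L2 (\<lambda>t. f t + g t)"
proof -
  note [measurable] = assms[THEN exp_L2_measurable]
  obtain \<sigma> \<rho> where *: "\<sigma> \<ge> 0" "integrable lborel (\<lambda>t. exp (- (\<sigma> * t)) * (f t)\<^sup>2)"
      "\<rho> \<ge> 0" "integrable lborel (\<lambda>t. exp (- (\<rho> * t)) * (g t)\<^sup>2)"
    using assms by (auto simp: exp_L2_def)
  define c where "c = max \<sigma> \<rho>"
  have c: "integrable lborel (\<lambda>t. exp (- (c * t)) * (f t)\<^sup>2)"
    "integrable lborel (\<lambda>t. exp (- (c * t)) * (g t)\<^sup>2)"
    using * assms exp_L2_weight_mono unfolding c_def by (meson max.cobounded1 max.cobounded2)+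
  have "integrable lborel (\<lambda>t. exp (- (c * t)) * (f t + g t)\<^sup>2)"
  proof (rule Bochner_Integration.integrable_bound)
    show "integrable lborel (\<lambda>t. 2 * (exp (- (c * t)) * (f t)\<^sup>2) + 2 * (exp (- (c * t)) * (g t)\<^sup>2))"
      using c by auto
    have "(f t + g t)\<^sup>2 \<le> 2 * (f t)\<^sup>2 + 2 * (g t)\<^sup>2" for t
      using zero_le_power2[of "f t - g t"] by (simp add: power2_eq_square algebra_simps)
    then have "exp (- (c * t)) * (f t + g t)\<^sup>2 \<le> exp (- (c * t)) * (2 * (f t)\<^sup>2 + 2 * (g t)\<^sup>2)" for t
      by (intro mult_left_mono) auto
    then show "AE t in lborel. norm (exp (- (c * t)) * (f t + g t)\<^sup>2) \<le>
        norm (2 * (exp (- (c * t)) * (f t)\<^sup>2) + 2 * (exp (- (c * t)) * (g t)\<^sup>2))"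
      by (simp add: algebra_simps)
  qed measurable
  then show ?thesis
    using assms *(1) unfolding exp_L2_def signal_def c_def by (intro conjI exI[of _ c]) (auto simp: c_def)
qed

lemma exp_L2_exp_mult:
  assumes "exp_L2 g"
  shows "exp_L2 (\<lambda>t. exp (c * t) * g t)"
proof -
  note [measurable] = assms[THEN exp_L2_measurable]
  obtain \<sigma> where \<sigma>: "\<sigma> \<ge> 0" "integrable lborel (\<lambda>t. exp (- (\<sigma> * t)) * (g t)\<^sup>2)"
    using assms by (auto simp: exp_L2_def)
  \<comment> \<open>The exact compensating weight is \<open>\<sigma> + 2 * c\<close>; the absolute
    value keeps the exponent nonnegative for negative \<open>c\<close>.\<close>
  define \<rho> where "\<rho> = \<sigma> + 2 * \<bar>c\<bar>"
  have eq: "exp (- ((\<sigma> + 2 * c) * t)) * (exp (c * t) * g t)\<^sup>2 = exp (- (\<sigma> * t)) * (g t)\<^sup>2" for t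
  proof -
    have "exp (- ((\<sigma> + 2 * c) * t)) * (exp (c * t) * exp (c * t)) = exp (- (\<sigma> * t))"
      by (simp add: exp_add[symmetric] algebra_simps)
    then show ?thesis
      by (simp add: power_mult_distrib power2_eq_square mult_ac)
  qed
  have "integrable lborel (\<lambda>t. exp (- (\<rho> * t)) * (exp (c * t) * g t)\<^sup>2)"
  proof (rule Bochner_Integration.integrable_bound[OF \<sigma>(2)])
    have "exp (- (\<rho> * t)) * (exp (c * t) * g t)\<^sup>2 \<le> exp (- (\<sigma> * t)) * (g t)\<^sup>2" for t
    proof (cases "t < 0")
      case False
      then have "(\<sigma> + 2 * c) * t \<le> \<rho> * t"
        by (intro mult_right_mono) (auto simp: \<rho>_def)
      then show ?thesis
        unfolding eq[symmetric] by (intro mult_right_mono) auto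
    qed (simp add: exp_L2_nonneg_time[OF assms])
    then show "AE t in lborel. norm (exp (- (\<rho> * t)) * (exp (c * t) * g t)\<^sup>2) \<le>
        norm (exp (- (\<sigma> * t)) * (g t)\<^sup>2)"
      by simp
  qed measurable
  then show ?thesis
    using assms \<sigma>(1) unfolding exp_L2_def signal_def
    by (intro conjI exI[of _ \<rho>]) (auto simp: \<rho>_def)
qed

lemma exp_L2_cmult:
  assumes "exp_L2 g"
  shows "exp_L2 (\<lambda>t. c * g t)"
proof -
  note [measurable] = assms[THEN exp_L2_measurable]
  obtain \<sigma> where \<sigma>: "\<sigma> \<ge> 0" "integrable lborel (\<lambda>t. exp (- (\<sigma> * t)) * (g t)\<^sup>2)"
    using assms by (auto simp: exp_L2_def)
  have "integrable lborel (\<lambda>t. c\<^sup>2 * (exp (- (\<sigma> * t)) * (g t)\<^sup>2))"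
    using \<sigma>(2) by simp
  then have "integrable lborel (\<lambda>t. exp (- (\<sigma> * t)) * (c * g t)\<^sup>2)"
    by (simp add: power_mult_distrib mult_ac)
  then show ?thesis
    using assms \<sigma>(1) unfolding exp_L2_def signal_def by auto
qed

lemma exp_L2_diff: "exp_L2 f \<Longrightarrow> exp_L2 g \<Longrightarrow> exp_L2 (\<lambda>t. f t - g t)"
  using exp_L2_add[of f "\<lambda>t. (-1) * g t"] exp_L2_cmult[of g "-1"] by simp

lemma exp_L2_finite_L2: "signal g \<Longrightarrow> finite_L2 g \<Longrightarrow> exp_L2 g"
  by (auto simp: exp_L2_def finite_L2_def intro!: exI[of _ 0])

text \<open>On a bounded interval the weight is bounded away from 0, so both factors are locally
  square integrable, and twice the absolute product is at most the sum of the squares.\<close>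

lemma exp_L2_set_integrable_mult:
  assumes "exp_L2 f" "exp_L2 g"
  shows "set_integrable lborel {0..T} (\<lambda>t. f t * g t)"
proof -
  note [measurable] = assms[THEN exp_L2_measurable]
  have sq: "set_integrable lborel {0..T} (\<lambda>t. (h t)\<^sup>2)" if h: "exp_L2 h" for h
  proof -
    note [measurable] = h[THEN exp_L2_measurable]
    obtain \<sigma> where \<sigma>: "\<sigma> \<ge> 0" "integrable lborel (\<lambda>t. exp (- (\<sigma> * t)) * (h t)\<^sup>2)"
      using h by (auto simp: exp_L2_def)
    have *: "(h t)\<^sup>2 \<le> exp (\<sigma> * T) * (exp (- (\<sigma> * t)) * (h t)\<^sup>2)" if "t \<in> {0..T}" for t
    proof -
      have "1 \<le> exp (\<sigma> * T) * exp (- (\<sigma> * t))"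
        using that \<sigma>(1) by (simp add: exp_add[symmetric] mult_left_mono)
      then have "1 * (h t)\<^sup>2 \<le> (exp (\<sigma> * T) * exp (- (\<sigma> * t))) * (h t)\<^sup>2"
        by (intro mult_right_mono) auto
      then show ?thesis
        by (simp add: mult_ac)
    qed
    show ?thesis
      unfolding set_integrable_def
    proof (rule Bochner_Integration.integrable_bound)
      show "integrable lborel (\<lambda>t. exp (\<sigma> * T) * (exp (- (\<sigma> * t)) * (h t)\<^sup>2))"
        using \<sigma> by simp
      show "AE t in lborel. norm (indicator {0..T} t *\<^sub>R (h t)\<^sup>2) \<le>
          norm (exp (\<sigma> * T) * (exp (- (\<sigma> * t)) * (h t)\<^sup>2))"
        using * by (intro AE_I2) (auto simp: indicator_def)
    qed measurable
  qed
  have "set_integrable lborel {0..T} (\<lambda>t. (f t)\<^sup>2 + (g t)\<^sup>2)"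
    using sq[OF assms(1)] sq[OF assms(2)] by (rule set_integral_add)
  then show ?thesis
    unfolding set_integrable_def
  proof (rule Bochner_Integration.integrable_bound)
    have "\<bar>f t * g t\<bar> \<le> (f t)\<^sup>2 + (g t)\<^sup>2" for t
    proof -
      have "2 * (\<bar>f t\<bar> * \<bar>g t\<bar>) \<le> (f t)\<^sup>2 + (g t)\<^sup>2" "0 \<le> \<bar>f t\<bar> * \<bar>g t\<bar>"
        using sum_squares_bound[of "\<bar>f t\<bar>" "\<bar>g t\<bar>"] by (simp_all add: mult.assoc)
      then show ?thesis
        unfolding abs_mult by linarith
    qed
    then show "AE t in lborel. norm (indicator {0..T} t *\<^sub>R (f t * g t)) \<le>
        norm (indicator {0..T} t *\<^sub>R ((f t)\<^sup>2 + (g t)\<^sup>2))"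
      by (auto simp: indicator_def)
  qed measurable
qed

section \<open>Absolute integrability and exponential growth bounds\<close>

lemma integrable_exp_halfline:
  assumes "(c::real) > 0"
  shows "integrable lborel (\<lambda>t. indicator {0..} t * exp (- (c * t)))"
proof -
  have "integrable lborel (\<lambda>t. indicator {0<..} t * exp (- (t * c)))"
    using integrable_I0i_exp_mscale[OF assms] by (simp add: set_integrable_def)
  then show ?thesis
    by (rule integrable_discrete_difference[where X = "{0}", THEN iffD1, rotated -1])
      (auto simp: indicator_def mult.commute)
qed

text \<open>A pointwise Cauchy-Schwarz argument: the damped absolute value is dominated by the
  weighted energy density plus \<open>exp (- ((2 * c - \<sigma>) * t))\<close>, which is integrable
  on the half-line because \<open>c \<ge> \<sigma> + 1\<close> makes \<open>2 * c - \<sigma>\<close>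
  positive.\<close>

lemma exp_L2_abs_integrable:
  assumes "exp_L2 g"
  obtains \<rho> where "\<rho> > 0"
    "\<And>c. c \<ge> \<rho> \<Longrightarrow> integrable lborel (\<lambda>t. indicator {0..} t * (exp (- (c * t)) * \<bar>g t\<bar>))"
proof -
  note [measurable] = assms[THEN exp_L2_measurable]
  obtain \<sigma> where \<sigma>: "\<sigma> \<ge> 0" "integrable lborel (\<lambda>t. exp (- (\<sigma> * t)) * (g t)\<^sup>2)"
    using assms by (auto simp: exp_L2_def)
  show thesis
  proof (rule that[of "\<sigma> + 1"])
    fix c assume c: "c \<ge> \<sigma> + 1"
    show "integrable lborel (\<lambda>t. indicator {0..} t * (exp (- (c * t)) * \<bar>g t\<bar>))"
    proof (rule Bochner_Integration.integrable_bound)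
      show "integrable lborel (\<lambda>t. indicator {0..} t * exp (- ((2 * c - \<sigma>) * t)) +
          exp (- (\<sigma> * t)) * (g t)\<^sup>2)"
        using c \<sigma> by (intro Bochner_Integration.integrable_add integrable_exp_halfline) auto
      have "exp (- (c * t)) * \<bar>g t\<bar> \<le> exp (- ((2 * c - \<sigma>) * t)) + exp (- (\<sigma> * t)) * (g t)\<^sup>2" for t
      proof -
        have "0 \<le> exp (- (\<sigma> * t)) * (\<bar>g t\<bar> - exp (- ((c - \<sigma>) * t)))\<^sup>2"
          by simp
        also have "\<dots> = exp (- (\<sigma> * t)) * (g t)\<^sup>2 - 2 * (exp (- (\<sigma> * t)) * exp (- ((c - \<sigma>) * t))) * \<bar>g t\<bar> +
            exp (- (\<sigma> * t)) * (exp (- ((c - \<sigma>) * t)) * exp (- ((c - \<sigma>) * t)))"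
          by (simp add: power2_diff power2_eq_square[of "exp _"] algebra_simps)
        also have "exp (- (\<sigma> * t)) * exp (- ((c - \<sigma>) * t)) = exp (- (c * t))"
          by (simp add: exp_add[symmetric] algebra_simps)
        also have "exp (- (\<sigma> * t)) * (exp (- ((c - \<sigma>) * t)) * exp (- ((c - \<sigma>) * t))) =
            exp (- ((2 * c - \<sigma>) * t))"
          by (simp add: exp_add[symmetric] algebra_simps)
        finally have "2 * (exp (- (c * t)) * \<bar>g t\<bar>) \<le>
            exp (- ((2 * c - \<sigma>) * t)) + exp (- (\<sigma> * t)) * (g t)\<^sup>2"
          by simp
        moreover have "exp (- (c * t)) * \<bar>g t\<bar> \<ge> 0"
          by simp
        ultimately show ?thesis
          by linarith
      qed
      then show "AE t in lborel. norm (indicator {0..} t * (exp (- (c * t)) * \<bar>g t\<bar>)) \<le>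
          norm (indicator {0..} t * exp (- ((2 * c - \<sigma>) * t)) + exp (- (\<sigma> * t)) * (g t)\<^sup>2)"
        by (auto simp: indicator_def abs_mult)
    qed measurable
  qed (use \<sigma> in simp)
qed

lemma exp_L2_set_integrable:
  assumes "exp_L2 g"
  shows "set_integrable lborel {0..T} g"
proof -
  note [measurable] = assms[THEN exp_L2_measurable]
  have 1: "set_integrable lborel {0..T} (\<lambda>t. 1 + g t * g t)"
    by (intro set_integral_add exp_L2_set_integrable_mult assms)
      (simp add: set_integrable_def integrable_real_indicator emeasure_lborel_Icc_eq)
  then show ?thesis
    unfolding set_integrable_def
  proof (rule Bochner_Integration.integrable_bound)
    have "\<bar>g t\<bar> \<le> 1 + g t * g t" for t
    proof -
      have "2 * \<bar>g t\<bar> \<le> g t * g t + 1" "0 \<le> \<bar>g t\<bar>"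
        using sum_squares_bound[of "\<bar>g t\<bar>" 1] by (simp_all add: power2_eq_square)
      then show ?thesis
        by linarith
    qed
    then show "AE t in lborel. norm (indicator {0..T} t *\<^sub>R g t) \<le>
        norm (indicator {0..T} t *\<^sub>R (1 + g t * g t))"
      by (auto simp: indicator_def)
  qed measurable
qed

lemma measurable_running_integral:
  fixes g :: "real \<Rightarrow> real"
  assumes [measurable]: "g \<in> borel_measurable borel"
  shows "running_integral g \<in> borel_measurable borel"
proof -
  have "running_integral g = (\<lambda>t. LINT \<tau>|lborel. (if 0 \<le> \<tau> \<and> \<tau> \<le> t then g \<tau> else 0))"
    unfolding running_integral_def set_lebesgue_integral_def
    by (intro ext Bochner_Integration.integral_cong) auto
  also have "\<dots> \<in> borel_measurable borel"
    by measurable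
  finally show ?thesis .
qed

text \<open>For \<open>\<tau> \<le> t\<close> the factor \<open>exp (\<rho> * (t - \<tau>))\<close>
  is at least 1; inserting it under the integral leaves \<open>exp (\<rho> * t)\<close> times the
  damped absolute integral of \<open>g\<close> over the whole half-line, which is finite.\<close>

lemma running_integral_exp_bound:
  assumes "exp_L2 g"
  obtains M \<rho> where "\<rho> > 0" "\<And>t. t \<ge> 0 \<Longrightarrow> \<bar>running_integral g t\<bar> \<le> M * exp (\<rho> * t)"
proof -
  note [measurable] = assms[THEN exp_L2_measurable]
  obtain \<rho> where \<rho>: "\<rho> > 0"
    "integrable lborel (\<lambda>t. indicator {0..} t * (exp (- (\<rho> * t)) * \<bar>g t\<bar>))"
    using exp_L2_abs_integrable[OF assms] by (metis order_refl)
  define M where "M = (LINT t|lborel. indicator {0..} t * (exp (- (\<rho> * t)) * \<bar>g t\<bar>))"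
  show thesis
  proof (rule that[OF \<rho>(1)])
    fix t :: real assume t: "t \<ge> 0"
    have "\<bar>running_integral g t\<bar> \<le> (LINT \<tau>|lborel. \<bar>indicator {0..t} \<tau> *\<^sub>R g \<tau>\<bar>)"
      unfolding running_integral_def set_lebesgue_integral_def
      using integral_norm_bound[of lborel "\<lambda>\<tau>. indicator {0..t} \<tau> *\<^sub>R g \<tau>"] by simp
    also have "\<dots> \<le> (LINT \<tau>|lborel. exp (\<rho> * t) * (indicator {0..} \<tau> * (exp (- (\<rho> * \<tau>)) * \<bar>g \<tau>\<bar>)))"
    proof (rule integral_mono)
      show "integrable lborel (\<lambda>\<tau>. \<bar>indicator {0..t} \<tau> *\<^sub>R g \<tau>\<bar>)"
        using exp_L2_set_integrable[OF assms, of t] unfolding set_integrable_def by (rule integrable_abs)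
      show "integrable lborel (\<lambda>\<tau>. exp (\<rho> * t) * (indicator {0..} \<tau> * (exp (- (\<rho> * \<tau>)) * \<bar>g \<tau>\<bar>)))"
        using \<rho>(2) by (rule integrable_mult_right)
      fix \<tau> :: real
      have "\<bar>g \<tau>\<bar> \<le> exp (\<rho> * t) * (exp (- (\<rho> * \<tau>)) * \<bar>g \<tau>\<bar>)" if "\<tau> \<le> t"
      proof -
        have "1 \<le> exp (\<rho> * t) * exp (- (\<rho> * \<tau>))"
          using that \<rho>(1) by (simp add: exp_add[symmetric])
        then have "1 * \<bar>g \<tau>\<bar> \<le> (exp (\<rho> * t) * exp (- (\<rho> * \<tau>))) * \<bar>g \<tau>\<bar>"
          by (intro mult_right_mono) auto
        then show ?thesis
          by (simp add: mult_ac)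
      qed
      then show "\<bar>indicator {0..t} \<tau> *\<^sub>R g \<tau>\<bar> \<le>
          exp (\<rho> * t) * (indicator {0..} \<tau> * (exp (- (\<rho> * \<tau>)) * \<bar>g \<tau>\<bar>))"
        by (auto simp: indicator_def)
    qed
    also have "\<dots> = M * exp (\<rho> * t)"
      by (simp add: M_def)
    finally show "\<bar>running_integral g t\<bar> \<le> M * exp (\<rho> * t)" .
  qed
qed

lemma exp_L2_running_integral:
  assumes "exp_L2 g"
  shows "exp_L2 (running_integral g)"
proof -
  note [measurable] = assms[THEN exp_L2_measurable] measurable_running_integral
  obtain M \<rho> where \<rho>: "\<rho> > 0" "\<And>t. t \<ge> 0 \<Longrightarrow> \<bar>running_integral g t\<bar> \<le> M * exp (\<rho> * t)"
    using running_integral_exp_bound[OF assms] by blast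
  have neg: "running_integral g t = 0" if "t < 0" for t
    using that by (simp add: running_integral_def set_lebesgue_integral_def)
  \<comment> \<open>The part \<open>2 * \<rho>\<close> absorbs the growth of the square, and the
    extra 1 leaves the integrable majorant \<open>exp (- t)\<close>.\<close>
  have "integrable lborel (\<lambda>t. exp (- ((2 * \<rho> + 1) * t)) * (running_integral g t)\<^sup>2)"
  proof (rule Bochner_Integration.integrable_bound)
    show "integrable lborel (\<lambda>t. M\<^sup>2 * (indicator {0..} t * exp (- (1 * t))))"
      by (intro integrable_mult_right integrable_exp_halfline) auto
    have "exp (- ((2 * \<rho> + 1) * t)) * (running_integral g t)\<^sup>2 \<le> M\<^sup>2 * exp (- t)" if "t \<ge> 0" for t
    proof -
      have "(running_integral g t)\<^sup>2 \<le> (M * exp (\<rho> * t))\<^sup>2"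
        using power_mono[OF \<rho>(2)[OF that] abs_ge_zero, of 2] by simp
      then have "exp (- ((2 * \<rho> + 1) * t)) * (running_integral g t)\<^sup>2 \<le>
          exp (- ((2 * \<rho> + 1) * t)) * (M * exp (\<rho> * t))\<^sup>2"
        by (intro mult_left_mono) auto
      also have "\<dots> = M\<^sup>2 * (exp (- ((2 * \<rho> + 1) * t)) * (exp (\<rho> * t) * exp (\<rho> * t)))"
        by (simp add: power_mult_distrib power2_eq_square)
      also have "\<dots> = M\<^sup>2 * exp (- t)"
        by (simp add: exp_add[symmetric] algebra_simps)
      finally show ?thesis .
    qed
    then show "AE t in lborel. norm (exp (- ((2 * \<rho> + 1) * t)) * (running_integral g t)\<^sup>2) \<le>
        norm (M\<^sup>2 * (indicator {0..} t * exp (- (1 * t))))"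
      using neg by (auto simp: indicator_def)
  qed measurable
  then show ?thesis
    using \<rho>(1) neg unfolding exp_L2_def signal_def
    by (intro conjI exI[of _ "2 * \<rho> + 1"]) (auto intro: measurable_running_integral)
qed

section \<open>Laplace transforms of running integrals\<close>

text \<open>A property holds eventually in this filter if it holds for all \<open>s\<close> with
  real part beyond some abscissa. Finitely many abscissas thus merge without being tracked.\<close>

abbreviation right_half_planes :: "complex filter" where
  "right_half_planes \<equiv> filtercomap Re at_top"

lemma exp_L2_laplace_converges:
  assumes "exp_L2 g"
  shows "\<forall>\<^sub>F s in right_half_planes. laplace_converges g s"
proof -
  note [measurable] = assms[THEN exp_L2_measurable]
  obtain \<rho> where \<rho>: "\<And>c. c \<ge> \<rho> \<Longrightarrow> integrable lborel (\<lambda>t. indicator {0..} t * (exp (- (c * t)) * \<bar>g t\<bar>))"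
    using exp_L2_abs_integrable[OF assms] by metis
  have "laplace_converges g s" if "\<rho> \<le> Re s" for s
    unfolding laplace_converges_def set_integrable_def
  proof (rule Bochner_Integration.integrable_bound[OF \<rho>[OF that]])
    show "AE t in lborel. norm (indicator {0..} t *\<^sub>R (exp (- (s * complex_of_real t)) * complex_of_real (g t))) \<le>
        norm (indicator {0..} t * (exp (- (Re s * t)) * \<bar>g t\<bar>))"
      by (auto simp: norm_mult indicator_def)
  qed measurable
  then show ?thesis
    by (auto simp: eventually_filtercomap_at_top_linorder)
qed

section \<open>Linearity of transforms and running integrals\<close>

lemma laplace_add:
  assumes "laplace_converges f s" "laplace_converges g s"
  shows "laplace (\<lambda>t. f t + g t) s = laplace f s + laplace g s"
  using set_integral_add(2)[OF assms[unfolded laplace_converges_def]]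
  by (simp add: laplace_def algebra_simps)

lemma laplace_cmult: "laplace (\<lambda>t. c * g t) s = of_real c * laplace g s"
  by (simp add: laplace_def mult.left_commute)

lemma laplace_cmult_converges:
  "laplace_converges g s \<Longrightarrow> laplace_converges (\<lambda>t. c * g t) s"
  using set_integrable_mult_right[of "complex_of_real c" lborel "{0..}"]
  by (simp add: laplace_converges_def mult.left_commute)

lemma laplace_diff:
  assumes "laplace_converges f s" "laplace_converges g s"
  shows "laplace (\<lambda>t. f t - g t) s = laplace f s - laplace g s"
  using laplace_add[OF assms(1) laplace_cmult_converges[OF assms(2), of "-1"]] laplace_cmult[of "-1" g s]
  by simp

lemma running_integral_of_real:
  "running_integral (\<lambda>t. complex_of_real (g t)) t = complex_of_real (running_integral g t)"
  by (simp add: running_integral_def set_integral_complex_of_real)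

lemma running_integral_add:
  assumes "set_integrable lborel {0..t} f" "set_integrable lborel {0..t} g"
  shows "running_integral (\<lambda>t. f t + g t) t = running_integral f t + running_integral g t"
  using set_integral_add(2)[OF assms] by (simp add: running_integral_def)

lemma running_integral_diff:
  assumes "set_integrable lborel {0..t} f" "set_integrable lborel {0..t} g"
  shows "running_integral (\<lambda>t. f t - g t) t = running_integral f t - running_integral g t"
  using set_integral_diff(2)[OF assms] by (simp add: running_integral_def)

lemma running_integral_cmult:
  fixes c :: "'a::{banach, real_normed_field, second_countable_topology}"
  shows "running_integral (\<lambda>t. c * g t) t = c * running_integral g t"
  by (simp add: running_integral_def)

text \<open>Integration by parts on \<open>[0, T]\<close>, then \<open>T\<close> to infinity: the
  boundary term vanishes because \<open>Re s\<close> exceeds the growth rate \<open>\<rho>\<close>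
  of the running integral.\<close>

lemma laplace_running_integral:
  assumes g: "exp_L2 g"
  shows "\<forall>\<^sub>F s in right_half_planes. s * laplace (running_integral g) s = laplace g s"
proof -
  obtain M \<rho> where \<rho>: "\<rho> > 0" "\<And>t. t \<ge> 0 \<Longrightarrow> \<bar>running_integral g t\<bar> \<le> M * exp (\<rho> * t)"
    using running_integral_exp_bound[OF g] by blast
  have "\<forall>\<^sub>F s in right_half_planes. Re s > \<rho>"
    by (auto simp: eventually_filtercomap_at_top_dense)
  then show ?thesis
    using exp_L2_laplace_converges[OF g] exp_L2_laplace_converges[OF exp_L2_running_integral[OF g]]
  proof eventually_elim
    case (elim s)
    let ?R = "running_integral g"
    define E where "E t = exp (- (s * complex_of_real t))" for t
    have E_int: "running_integral (\<lambda>t. - (s * E t)) T = E T - 1"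
      "set_integrable lborel {0..T} (\<lambda>t. - (s * E t))" if "T \<ge> 0" for T
    proof -
      have deriv: "(E has_vector_derivative - (s * E t)) (at t within A)" for t A
        unfolding E_def by (rule has_vector_derivative_real_field) (auto intro!: derivative_eq_intros)
      have cont: "continuous_on {0..T} (\<lambda>t. - (s * E t))"
        unfolding E_def by (intro continuous_intros)
      show "set_integrable lborel {0..T} (\<lambda>t. - (s * E t))"
        using cont by (rule borel_integrable_atLeastAtMost')
      show "running_integral (\<lambda>t. - (s * E t)) T = E T - 1"
        using integral_FTC_Icc[OF that deriv cont] by (simp add: running_integral_def E_def set_lebesgue_integral_def)
    qed
    have part: "running_integral (\<lambda>t. E t * g t) T - s * running_integral (\<lambda>t. E t * ?R t) T = E T * ?R T"
      if "T \<ge> 0" for T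
    proof -
      have gT: "set_integrable lborel {0..T} (\<lambda>t. complex_of_real (g t))"
      proof -
        have "integrable lborel (\<lambda>t. complex_of_real (indicator {0..T} t *\<^sub>R g t))"
          using exp_L2_set_integrable[OF g, of T]
          unfolding set_integrable_def complex_of_real_integrable_eq .
        then show ?thesis
          by (simp add: set_integrable_def scaleR_conv_of_real)
      qed
      note m = running_integral_mult[OF E_int(2)[OF that] gT]
      \<comment> \<open>The primitive of the derivative of \<open>E\<close> is \<open>E - 1\<close>.
        Its constant part contributes minus the integral of \<open>g\<close>, which cancels the same
        term on the left of the product formula.\<close>
      have eq: "running_integral (\<lambda>t. running_integral (\<lambda>t. - (s * E t)) t * complex_of_real (g t)) T =
          running_integral (\<lambda>t. E t * g t - g t) T"
        unfolding running_integral_def[of _ T]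
        by (intro set_lebesgue_integral_cong) (auto simp: E_int algebra_simps)
      have "set_integrable lborel {0..T} (\<lambda>t. E t * g t)"
        using set_integral_add(1)[OF m(2) gT]
        by (rule set_integrable_cong[THEN iffD1, rotated -1]) (auto simp: E_int algebra_simps)
      then have "running_integral (\<lambda>t. E t * g t - g t) T =
          running_integral (\<lambda>t. E t * g t) T - running_integral (\<lambda>t. complex_of_real (g t)) T"
        using gT unfolding running_integral_def by (rule set_integral_diff(2))
      moreover have "running_integral (\<lambda>t. - (s * E t) * running_integral (\<lambda>t. complex_of_real (g t)) t) T =
          - s * running_integral (\<lambda>t. E t * ?R t) T"
        using running_integral_cmult[of "- s" "\<lambda>t. E t * ?R t" T]
        by (simp add: running_integral_of_real mult.assoc)
      ultimately show ?thesis
        using m(3) that unfolding eq by (simp add: E_int running_integral_of_real algebra_simps)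
    qed
    have lim: "((\<lambda>T. running_integral (\<lambda>t. E t * h t) T) \<longlongrightarrow> laplace h s) at_top"
      if "laplace_converges h s" for h
      unfolding running_integral_def laplace_def E_def
      using that by (intro tendsto_set_lebesgue_integral_at_top) (auto simp: laplace_converges_def)
    have "((\<lambda>T. E T * ?R T) \<longlongrightarrow> laplace g s - s * laplace ?R s) at_top"
    proof (rule Lim_transform_eventually)
      show "((\<lambda>T. running_integral (\<lambda>t. E t * g t) T - s * running_integral (\<lambda>t. E t * ?R t) T)
          \<longlongrightarrow> laplace g s - s * laplace ?R s) at_top"
        using elim by (intro tendsto_intros lim)
      show "\<forall>\<^sub>F T in at_top. running_integral (\<lambda>t. E t * g t) T - s * running_integral (\<lambda>t. E t * ?R t) T = E T * ?R T"
        using eventually_ge_at_top[of 0] by eventually_elim (rule part)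
    qed
    moreover have "((\<lambda>T. E T * ?R T) \<longlongrightarrow> 0) at_top"
    proof (rule Lim_null_comparison)
      show "\<forall>\<^sub>F T in at_top. norm (E T * ?R T) \<le> M * exp (- ((Re s - \<rho>) * T))"
        using eventually_ge_at_top[of 0]
      proof eventually_elim
        case (elim T)
        have "norm (E T * ?R T) = exp (- (Re s * T)) * \<bar>?R T\<bar>"
          by (simp add: E_def norm_mult)
        also have "\<dots> \<le> exp (- (Re s * T)) * (M * exp (\<rho> * T))"
          using \<rho>(2)[OF elim] by (intro mult_left_mono) auto
        also have "\<dots> = M * exp (- ((Re s - \<rho>) * T))"
          by (simp add: exp_add[symmetric] algebra_simps)
        finally show ?case .
      qed
      show "((\<lambda>T. M * exp (- ((Re s - \<rho>) * T))) \<longlongrightarrow> 0) at_top"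
        using elim(1) by real_asymp
    qed
    ultimately show ?case
      using tendsto_unique[OF trivial_limit_at_top_linorder] by fastforce
  qed
qed

text \<open>The lag \<open>exp_lag p g\<close> solves \<open>y' = g - p y\<close>, \<open>y 0 = 0\<close>; its transfer function is \<open>1 / (s + p)\<close>.\<close>

definition exp_lag :: "real \<Rightarrow> (real \<Rightarrow> real) \<Rightarrow> real \<Rightarrow> real" where
  "exp_lag p g t = exp (- (p * t)) * running_integral (\<lambda>\<tau>. exp (p * \<tau>) * g \<tau>) t"

lemma exp_L2_exp_lag: "exp_L2 g \<Longrightarrow> exp_L2 (exp_lag p g)"
  using exp_L2_exp_mult[of "running_integral (\<lambda>\<tau>. exp (p * \<tau>) * g \<tau>)" "- p"]
  by (simp add: exp_lag_def[abs_def] exp_L2_running_integral exp_L2_exp_mult)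

text \<open>This is the equation \<open>y' = g - p y\<close> in integrated form, since
  \<open>g\<close> is merely measurable. It follows from integration by parts with the factors
  \<open>exp (- (p * t)) - 1\<close> and the running integral of
  \<open>exp (p * t) * g t\<close>.\<close>

lemma exp_lag_eq_running_integral:
  assumes "exp_L2 g"
  shows "exp_lag p g T = running_integral (\<lambda>t. g t - p * exp_lag p g t) T"
proof (cases "T \<ge> 0")
  case True
  let ?b = "\<lambda>t. exp (p * t) * g t"
  have E: "running_integral (\<lambda>t. - (p * exp (- (p * t)))) T = exp (- (p * T)) - 1"
    "set_integrable lborel {0..T} (\<lambda>t. - (p * exp (- (p * t))))" if "T \<ge> 0" for T
  proof -
    have deriv: "((\<lambda>t. exp (- (p * t))) has_vector_derivative - (p * exp (- (p * t)))) (at t within A)" for t A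
      by (auto intro!: derivative_eq_intros simp flip: has_real_derivative_iff_has_vector_derivative)
    have cont: "continuous_on {0..T} (\<lambda>t. - (p * exp (- (p * t))))"
      by (intro continuous_intros)
    show "set_integrable lborel {0..T} (\<lambda>t. - (p * exp (- (p * t))))"
      using cont by (rule borel_integrable_atLeastAtMost')
    show "running_integral (\<lambda>t. - (p * exp (- (p * t)))) T = exp (- (p * T)) - 1"
      using integral_FTC_Icc[OF that deriv cont] by (simp add: running_integral_def set_lebesgue_integral_def)
  qed
  have b: "exp_L2 ?b"
    using assms by (rule exp_L2_exp_mult)
  note m = running_integral_mult(3)[OF E(2)[OF True] exp_L2_set_integrable[OF b]]
  have "running_integral (\<lambda>t. running_integral (\<lambda>t. - (p * exp (- (p * t)))) t * ?b t) T =
      running_integral (\<lambda>t. g t - ?b t) T"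
    unfolding running_integral_def[of _ T]
  proof (intro set_lebesgue_integral_cong allI impI)
    fix t assume "t \<in> {0..T}"
    moreover have "(exp (- (p * t)) - 1) * ?b t = g t - ?b t"
      by (simp add: exp_minus field_simps)
    ultimately show "running_integral (\<lambda>t. - (p * exp (- (p * t)))) t * ?b t = g t - ?b t"
      by (simp add: E)
  qed auto
  moreover have "running_integral (\<lambda>t. - (p * exp (- (p * t))) * running_integral ?b t) T =
      - p * running_integral (exp_lag p g) T"
    using running_integral_cmult[of "- p" "exp_lag p g" T]
    by (simp add: exp_lag_def[abs_def] mult.assoc)
  ultimately have "(exp (- (p * T)) - 1) * running_integral ?b T =
      - p * running_integral (exp_lag p g) T + (running_integral g T - running_integral ?b T)"
    using m running_integral_diff[OF assms[THEN exp_L2_set_integrable] b[THEN exp_L2_set_integrable]] by (simp add: E True)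
  then have "exp_lag p g T = running_integral g T - p * running_integral (exp_lag p g) T"
    by (simp add: exp_lag_def algebra_simps)
  also have "\<dots> = running_integral (\<lambda>t. g t - p * exp_lag p g t) T"
    by (simp add: running_integral_diff exp_L2_set_integrable exp_L2_cmult exp_L2_exp_lag assms
      running_integral_cmult)
  finally show ?thesis .
qed (simp add: exp_lag_def running_integral_def set_lebesgue_integral_def)

section \<open>Dissipation in a follower loop\<close>

text \<open>This encodes the differential equation \<open>y' = g\<close> with
  \<open>y 0 = 0\<close>, the derivative being understood almost everywhere.\<close>

definition primitive :: "(real \<Rightarrow> real) \<Rightarrow> (real \<Rightarrow> real) \<Rightarrow> bool" where
  "primitive y g \<longleftrightarrow> exp_L2 g \<and> y = running_integral g"

lemma primitive_exp_L2: "primitive y g \<Longrightarrow> exp_L2 y"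
  by (simp add: primitive_def exp_L2_running_integral)

lemma primitive_diff:
  "primitive x f \<Longrightarrow> primitive y g \<Longrightarrow> primitive (\<lambda>t. x t - y t) (\<lambda>t. f t - g t)"
  by (auto simp: primitive_def running_integral_diff exp_L2_set_integrable intro: exp_L2_diff)

lemma primitive_cmult: "primitive y g \<Longrightarrow> primitive (\<lambda>t. c * y t) (\<lambda>t. c * g t)"
  by (auto simp: primitive_def running_integral_cmult intro: exp_L2_cmult)

lemma primitive_square:
  assumes "primitive y g"
  shows "set_integrable lborel {0..T} (\<lambda>t. g t * y t)"
    and "y T * y T = 2 * running_integral (\<lambda>t. g t * y t) T"
proof -
  have g: "exp_L2 g" and y: "y = running_integral g"
    using assms by (auto simp: primitive_def)
  note m = running_integral_mult[OF exp_L2_set_integrable[OF g, of T] exp_L2_set_integrable[OF g, of T]]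
  show "set_integrable lborel {0..T} (\<lambda>t. g t * y t)"
    using m(1) by (simp add: y)
  show "y T * y T = 2 * running_integral (\<lambda>t. g t * y t) T"
    using m(3) by (simp add: y mult.commute)
qed

lemma primitive_laplace:
  "primitive y g \<Longrightarrow> \<forall>\<^sub>F s in right_half_planes. s * laplace y s = laplace g s"
  by (simp add: primitive_def laplace_running_integral)

text \<open>The follower loop for the gains \<open>K(s) = 3/4 + 1/(4 s)\<close> and \<open>h = 3\<close>: \<open>a\<close> and \<open>f\<close> are the
  accelerations of the predecessor and of the vehicle, \<open>q\<close> is their relative velocity, \<open>e\<close> the
  configuration error and \<open>z\<close> its integral.\<close>

definition follower ::
  "(real \<Rightarrow> real) \<Rightarrow> (real \<Rightarrow> real) \<Rightarrow> (real \<Rightarrow> real) \<Rightarrow> (real \<Rightarrow> real) \<Rightarrow> (real \<Rightarrow> real) \<Rightarrow>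
   (real \<Rightarrow> real) \<Rightarrow> bool" where
  "follower a d z e q f \<longleftrightarrow> exp_L2 a \<and> exp_L2 d \<and>
     primitive z e \<and> primitive e (\<lambda>t. q t - 3 * f t) \<and> primitive q (\<lambda>t. a t - f t) \<and>
     f = (\<lambda>t. d t + 3 / 4 * e t + 1 / 4 * z t)"

lemma follower_exp_L2:
  assumes "follower a d z e q f"
  shows "exp_L2 z" "exp_L2 e" "exp_L2 q" "exp_L2 f"
proof -
  show *: "exp_L2 z" "exp_L2 e" "exp_L2 q"
    using assms unfolding follower_def by (blast intro: primitive_exp_L2)+
  have f: "f = (\<lambda>t. d t + 3 / 4 * e t + 1 / 4 * z t)" "exp_L2 d"
    using assms by (auto simp only: follower_def)
  show "exp_L2 f"
    unfolding f(1) by (intro exp_L2_add exp_L2_cmult f(2) *)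
qed

text \<open>The characteristic polynomial of the loop is \<open>(s + 1)\<^sup>2 (s + 1/4)\<close>, so that the response is a
  combination of cascaded lags.\<close>

lemma follower_exists:
  assumes "exp_L2 a" "exp_L2 d"
  shows "\<exists>z e q f. follower a d z e q f"
proof -
  have lag: "primitive (exp_lag p g) (\<lambda>t. g t - p * exp_lag p g t)" if "exp_L2 g" for p g
    unfolding primitive_def
  proof
    show "exp_L2 (\<lambda>t. g t - p * exp_lag p g t)"
      by (intro exp_L2_diff exp_L2_cmult exp_L2_exp_lag that)
    show "exp_lag p g = running_integral (\<lambda>t. g t - p * exp_lag p g t)"
      by (rule ext) (rule exp_lag_eq_running_integral[OF that])
  qed
  define A1 where "A1 = exp_lag 1 a"
  define A2 where "A2 = exp_lag 1 A1"
  define A3 where "A3 = exp_lag (1 / 4) A2"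
  define D1 where "D1 = exp_lag 1 d"
  define D2 where "D2 = exp_lag 1 D1"
  define D3 where "D3 = exp_lag (1 / 4) D2"
  have E: "exp_L2 A1" "exp_L2 A2" "exp_L2 D1" "exp_L2 D2"
    unfolding A1_def A2_def D1_def D2_def by (intro exp_L2_exp_lag assms)+
  note P = lag[OF assms(1), of 1, folded A1_def] lag[OF E(1), of 1, folded A2_def]
    lag[OF E(2), of "1/4", folded A3_def] lag[OF assms(2), of 1, folded D1_def]
    lag[OF E(3), of 1, folded D2_def] lag[OF E(4), of "1/4", folded D3_def]
  \<comment> \<open>In the Laplace domain
    \<open>z = (a - (1 + 3 s) d) / ((s + 1)^2 (s + 1/4))\<close>, and
    \<open>1 + 3 s = 3 (s + 1/4) + 1/4\<close> splits the disturbance part. The coefficients of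
    \<open>e\<close> and \<open>q\<close> come from \<open>e = s z\<close> and
    \<open>q = s e + 3 f\<close>. Signs and unit factors are spelled out so that differences and
    multiples of primitives suffice.\<close>
  define z where "z t = A3 t - 3 * D2 t - 1 / 4 * D3 t" for t
  define e where "e t = A2 t - 1 / 4 * A3 t - 3 * D1 t - (- 11 / 4) * D2 t - (- 1 / 16) * D3 t" for t
  define f where "f t = d t + 3 / 4 * e t + 1 / 4 * z t" for t
  define q where "q t = A1 t - (- 1) * A2 t - (- 1 / 4) * A3 t - 1 * D1 t - (- 5 / 4) * D2 t - 1 / 16 * D3 t" for t
  have "primitive z e"
  proof -
    have "primitive z (\<lambda>t. (A2 t - 1 / 4 * A3 t) - 3 * (D1 t - 1 * D2 t) - 1 / 4 * (D2 t - 1 / 4 * D3 t))"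
      unfolding z_def[abs_def] by (intro primitive_diff primitive_cmult P)
    also have "(\<lambda>t. (A2 t - 1 / 4 * A3 t) - 3 * (D1 t - 1 * D2 t) - 1 / 4 * (D2 t - 1 / 4 * D3 t)) = e"
      by (simp add: fun_eq_iff e_def algebra_simps)
    finally show ?thesis .
  qed
  moreover have "primitive e (\<lambda>t. q t - 3 * f t)"
  proof -
    have "primitive e (\<lambda>t. (A1 t - 1 * A2 t) - 1 / 4 * (A2 t - 1 / 4 * A3 t) - 3 * (d t - 1 * D1 t)
        - (- 11 / 4) * (D1 t - 1 * D2 t) - (- 1 / 16) * (D2 t - 1 / 4 * D3 t))"
      unfolding e_def[abs_def] by (intro primitive_diff primitive_cmult P)
    also have "\<dots> = (\<lambda>t. q t - 3 * f t)"
      by (simp add: fun_eq_iff q_def e_def z_def f_def field_simps)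
    finally show ?thesis .
  qed
  moreover have "primitive q (\<lambda>t. a t - f t)"
  proof -
    have "primitive q (\<lambda>t. (a t - 1 * A1 t) - (- 1) * (A1 t - 1 * A2 t) - (- 1 / 4) * (A2 t - 1 / 4 * A3 t) -
        1 * (d t - 1 * D1 t) - (- 5 / 4) * (D1 t - 1 * D2 t) - 1 / 16 * (D2 t - 1 / 4 * D3 t))"
      unfolding q_def[abs_def] by (intro primitive_diff primitive_cmult P)
    also have "\<dots> = (\<lambda>t. a t - f t)"
      by (simp add: fun_eq_iff e_def z_def f_def field_simps)
    finally show ?thesis .
  qed
  moreover have "f = (\<lambda>t. d t + 3 / 4 * e t + 1 / 4 * z t)"
    by (simp add: fun_eq_iff f_def)
  ultimately have "follower a d z e q f"
    unfolding follower_def by (intro conjI assms)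
  then show ?thesis
    by blast
qed

text \<open>With \<open>r = q - 3/4 z\<close>, the storage function is \<open>q\<^sup>2/3 + 9/2 (e - 4/9 r)\<^sup>2 + 5/18 r\<^sup>2\<close>. Its weights
  solve the bounded-real matrix inequality of the loop; the term \<open>q\<^sup>2/3\<close> is forced by the tight gain
  1 at frequency 0.\<close>

lemma follower_dissipation:
  assumes "follower a d z e q f"
  shows "3 / 16 * running_integral (\<lambda>t. e t * e t) T + running_integral (\<lambda>t. f t * f t) T \<le>
    running_integral (\<lambda>t. a t * a t) T + 14 * running_integral (\<lambda>t. d t * d t) T"
proof -
  have P: "primitive z e" "primitive e (\<lambda>t. q t - 3 * f t)" "primitive q (\<lambda>t. a t - f t)"
    and L2: "exp_L2 a" "exp_L2 d" "exp_L2 e" "exp_L2 f"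
    and f: "\<And>t. f t = d t + 3 / 4 * e t + 1 / 4 * z t"
    using assms follower_exp_L2[OF assms] by (auto simp: follower_def)
  define r where "r t = q t - 3 / 4 * z t" for t
  define r' where "r' t = a t - f t - 3 / 4 * e t" for t
  define y where "y t = e t - 4 / 9 * r t" for t
  define y' where "y' t = q t - 3 * f t - 4 / 9 * r' t" for t
  have r: "primitive r r'"
    unfolding r_def[abs_def] r'_def[abs_def] by (intro primitive_diff primitive_cmult P)
  have y: "primitive y y'"
    unfolding y_def[abs_def] y'_def[abs_def] by (intro primitive_diff primitive_cmult P r)
  note I = primitive_square(1)[OF P(3)] primitive_square(1)[OF r] primitive_square(1)[OF y]
    exp_L2_set_integrable_mult[OF L2(1) L2(1)] exp_L2_set_integrable_mult[OF L2(2) L2(2)]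
    exp_L2_set_integrable_mult[OF L2(3) L2(3)] exp_L2_set_integrable_mult[OF L2(4) L2(4)]
  \<comment> \<open>\<open>?V'\<close> is the derivative of the storage function along the loop and
    \<open>?w\<close> the supply rate. The loop starts at rest, so the integral of
    \<open>?V'\<close> is the stored value at time \<open>T\<close>.\<close>
  let ?V' = "\<lambda>t. 2 / 3 * ((a t - f t) * q t) + 9 * (y' t * y t) + 5 / 9 * (r' t * r t)"
  let ?w = "\<lambda>t. a t * a t - f t * f t - 3 / 16 * (e t * e t) + 14 * (d t * d t)"
  have "0 \<le> 1 / 3 * (q T * q T) + 9 / 2 * (y T * y T) + 5 / 18 * (r T * r T)"
    by (intro add_nonneg_nonneg mult_nonneg_nonneg[OF _ zero_le_square]) auto
  also have "\<dots> = running_integral ?V' T"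
    by (simp only: running_integral_add running_integral_cmult set_integral_add(1) set_integrable_mult_right I
        primitive_square(2)[OF P(3)] primitive_square(2)[OF r] primitive_square(2)[OF y])
  also have "\<dots> \<le> running_integral ?w T"
    unfolding running_integral_def
  proof (rule set_integral_mono)
    show "set_integrable lborel {0..T} ?V'" "set_integrable lborel {0..T} ?w"
      by (intro set_integral_add(1) set_integral_diff(1) set_integrable_mult_right I)+
    show "?V' t \<le> ?w t" for t
    proof -
      \<comment> \<open>Squares are completed successively in \<open>a - f\<close>, \<open>r\<close>
        and \<open>e\<close>; the weight 14 on the disturbance is large enough to leave the positive
        coefficient 33/40 of \<open>d^2\<close>.\<close>
      have "?w t - ?V' t = (a t - f t + 11 / 4 * e t - 3 / 2 * r t + d t)\<^sup>2 +
          7 / 4 * (r t - 16 / 7 * e t - 18 / 7 * d t)\<^sup>2 + 5 / 14 * (e t + 13 / 10 * d t)\<^sup>2 +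
          (13 - 81 / 7 - 169 / 280) * (d t)\<^sup>2"
        unfolding y_def y'_def r_def r'_def f by (simp add: power2_eq_square field_simps)
      also have "\<dots> \<ge> 0"
        by simp
      finally show ?thesis
        by simp
    qed
  qed
  also have "\<dots> = running_integral (\<lambda>t. a t * a t) T - running_integral (\<lambda>t. f t * f t) T -
      3 / 16 * running_integral (\<lambda>t. e t * e t) T + 14 * running_integral (\<lambda>t. d t * d t) T"
    by (simp only: running_integral_add running_integral_diff running_integral_cmult
        set_integral_add(1) set_integral_diff(1) set_integrable_mult_right I)
  finally show ?thesis
    by simp
qed

section \<open>Chains of followers\<close>

text \<open>Influence runs only from predecessor to follower, so the accelerations are defined by
  recursion along the chain. The leader has zero control, hence \<open>f 0 = d 0\<close>.\<close>

lemma platoon_exists: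
  assumes d: "\<And>i. exp_L2 (d i)"
  shows "\<exists>z e q f. f 0 = d 0 \<and>
    (\<forall>i. follower (f i) (d (Suc i)) (z (Suc i)) (e (Suc i)) (q (Suc i)) (f (Suc i)))"
proof -
  obtain Z E Q F where step: "\<And>a b. exp_L2 a \<Longrightarrow> exp_L2 b \<Longrightarrow> follower a b (Z a b) (E a b) (Q a b) (F a b)"
    using follower_exists by metis
  define f where "f = rec_nat (d 0) (\<lambda>i a. F a (d (Suc i)))"
  have f: "exp_L2 (f i)" for i
  proof (induction i)
    case (Suc i)
    then show ?case
      using follower_exp_L2(4)[OF step[OF Suc d[of "Suc i"]]] by (simp add: f_def)
  qed (simp add: f_def d)
  have f0: "f 0 = d 0"
    by (simp add: f_def)
  have "follower (f i) (d (Suc i)) (Z (f i) (d (Suc i))) (E (f i) (d (Suc i))) (Q (f i) (d (Suc i)))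
      (f (Suc i))" for i
    using step[OF f[of i] d[of "Suc i"]] by (simp add: f_def)
  then show ?thesis
    by (intro exI[of _ "\<lambda>i. Z (f (i - 1)) (d i)"] exI[of _ "\<lambda>i. E (f (i - 1)) (d i)"]
        exI[of _ "\<lambda>i. Q (f (i - 1)) (d i)"] exI[of _ f]) (simp add: f0)
qed

text \<open>The induction carries the acceleration energy of the last vehicle on the left-hand side:
  it is exactly what the dissipation inequality of the next vehicle consumes.\<close>

lemma platoon_energy:
  assumes f0: "f 0 = d 0"
    and step: "\<And>i. follower (f i) (d (Suc i)) (z (Suc i)) (e (Suc i)) (q (Suc i)) (f (Suc i))"
  shows "3 / 16 * (\<Sum>i\<in>{1..N}. running_integral (\<lambda>t. e i t * e i t) T) \<le>
    14 * (\<Sum>i\<in>{0..N}. running_integral (\<lambda>t. d i t * d i t) T)"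
proof -
  have pos: "running_integral (\<lambda>t. g t * g t) T \<ge> 0" for g :: "real \<Rightarrow> real"
    unfolding running_integral_def set_lebesgue_integral_def by (rule integral_nonneg_AE) auto
  have "3 / 16 * (\<Sum>i\<in>{1..N}. running_integral (\<lambda>t. e i t * e i t) T) +
      running_integral (\<lambda>t. f N t * f N t) T \<le>
      14 * (\<Sum>i\<in>{0..N}. running_integral (\<lambda>t. d i t * d i t) T)"
  proof (induction N)
    case 0
    then show ?case
      using pos[of "d 0"] by (simp add: f0)
  next
    case (Suc N)
    then show ?case
      using follower_dissipation[OF step[of N], of T] by (simp add: distrib_left)
  qed
  then show ?thesis
    using pos[of "f N"] by linarith
qed

text \<open>Monotone convergence along integer horizons turns a bound that is uniform in time into
  finite energy.\<close>

lemma finite_L2_if_truncated_bounded: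
  assumes g: "exp_L2 g" and bound: "\<And>n::nat. running_integral (\<lambda>t. g t * g t) (real n) \<le> B"
  shows "finite_L2 g"
    and "(\<lambda>n. running_integral (\<lambda>t. g t * g t) (real n)) \<longlonglongrightarrow> (LINT t|lborel. (g t)\<^sup>2)"
proof -
  note [measurable] = g[THEN exp_L2_measurable]
  let ?I = "\<lambda>n. running_integral (\<lambda>t. g t * g t) (real n)"
  let ?h = "\<lambda>n t. indicator {0..real n} t *\<^sub>R (g t * g t)"
  have int: "integrable lborel (?h n)" for n
    using exp_L2_set_integrable_mult[OF g g] unfolding set_integrable_def .
  have mono: "?h n t \<le> ?h m t" if "n \<le> m" for n m t
    using that by (auto simp: indicator_def)
  have "incseq ?I"
    unfolding running_integral_def set_lebesgue_integral_def
    by (intro incseq_SucI integral_mono int mono) simp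
  moreover have "bdd_above (range ?I)"
    by (rule bdd_aboveI2) (rule bound)
  ultimately obtain L where L: "?I \<longlonglongrightarrow> L"
    using LIMSEQ_incseq_SUP by blast
  have lim: "(\<lambda>n. ?h n t) \<longlonglongrightarrow> (g t)\<^sup>2" for t
  proof (rule tendsto_eventually)
    show "\<forall>\<^sub>F n in sequentially. ?h n t = (g t)\<^sup>2"
      using eventually_ge_at_top[of "nat \<lceil>t\<rceil>"]
    proof eventually_elim
      case (elim n)
      then have "t \<le> real n"
        by linarith
      then show ?case
        using exp_L2_nonneg_time[OF g, of t] by (auto simp: indicator_def power2_eq_square)
    qed
  qed
  have *: "AE t in lborel. mono (\<lambda>n. ?h n t)"
    using mono by (intro AE_I2 monoI) blast
  have **: "(\<lambda>n. integral\<^sup>L lborel (?h n)) \<longlonglongrightarrow> L"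
    using L unfolding running_integral_def set_lebesgue_integral_def .
  have meas: "(\<lambda>t. (g t)\<^sup>2) \<in> borel_measurable lborel"
    by measurable
  show "finite_L2 g"
    unfolding finite_L2_def by (rule integrable_monotone_convergence[OF int * AE_I2[OF lim] ** meas])
  have "(LINT t|lborel. (g t)\<^sup>2) = L"
    by (rule integral_monotone_convergence[OF int * AE_I2[OF lim] ** meas])
  then show "?I \<longlonglongrightarrow> (LINT t|lborel. (g t)\<^sup>2)"
    using L by simp
qed

text \<open>Finitely many eventual statements hold eventually together, which supplies one abscissa
  common to all vehicles.\<close>

lemma chain_responseI:
  assumes "\<And>i. i \<in> {0..N} \<Longrightarrow> signal (x i) \<and> signal (u i)" "\<And>i. i \<in> {1..N} \<Longrightarrow> signal (e i)"
    and ev: "\<And>i. i \<in> {0..N} \<Longrightarrow> \<forall>\<^sub>F s in right_half_planes. laplace_converges (d i) s \<and>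
        laplace_converges (x i) s \<and> laplace_converges (u i) s \<and>
        s\<^sup>2 * laplace (x i) s = laplace (u i) s + laplace (d i) s"
      "\<And>i. i \<in> {1..N} \<Longrightarrow> \<forall>\<^sub>F s in right_half_planes. laplace_converges (e i) s \<and>
        laplace (e i) s = laplace (x (i - 1)) s - laplace (x i) s - of_real h * s * laplace (x i) s \<and>
        laplace (u i) s = K s * laplace (e i) s"
      "\<forall>\<^sub>F s in right_half_planes. laplace (u 0) s = 0"
  shows "chain_response K h N d x u e"
proof -
  have "\<forall>\<^sub>F s in right_half_planes. \<forall>i\<in>{0..N}. laplace_converges (d i) s \<and>
        laplace_converges (x i) s \<and> laplace_converges (u i) s \<and>
        s\<^sup>2 * laplace (x i) s = laplace (u i) s + laplace (d i) s"
    by (rule eventually_ball_finite) (use ev(1) in auto)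
  moreover have "\<forall>\<^sub>F s in right_half_planes. \<forall>i\<in>{1..N}. laplace_converges (e i) s \<and>
        laplace (e i) s = laplace (x (i - 1)) s - laplace (x i) s - of_real h * s * laplace (x i) s \<and>
        laplace (u i) s = K s * laplace (e i) s"
    by (rule eventually_ball_finite) (use ev(2) in auto)
  ultimately have "\<forall>\<^sub>F s in right_half_planes. (\<forall>i\<in>{0..N}. laplace_converges (d i) s \<and>
        laplace_converges (x i) s \<and> laplace_converges (u i) s \<and>
        s\<^sup>2 * laplace (x i) s = laplace (u i) s + laplace (d i) s) \<and>
      (\<forall>i\<in>{1..N}. laplace_converges (e i) s \<and>
        laplace (e i) s = laplace (x (i - 1)) s - laplace (x i) s - of_real h * s * laplace (x i) s \<and>
        laplace (u i) s = K s * laplace (e i) s) \<and> laplace (u 0) s = 0"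
    using ev(3) by eventually_elim blast
  then obtain \<sigma> where \<sigma>: "\<And>s. Re s > \<sigma> \<Longrightarrow> (\<forall>i\<in>{0..N}. laplace_converges (d i) s \<and>
        laplace_converges (x i) s \<and> laplace_converges (u i) s \<and>
        s\<^sup>2 * laplace (x i) s = laplace (u i) s + laplace (d i) s) \<and>
      (\<forall>i\<in>{1..N}. laplace_converges (e i) s \<and>
        laplace (e i) s = laplace (x (i - 1)) s - laplace (x i) s - of_real h * s * laplace (x i) s \<and>
        laplace (u i) s = K s * laplace (e i) s) \<and> laplace (u 0) s = 0"
    by (auto simp: eventually_filtercomap_at_top_dense)
  show ?thesis
    unfolding chain_response_def
    by (intro conjI exI[of _ "max \<sigma> 0"]) (use assms(1,2) \<sigma> in auto)
qed

text \<open>At fixed \<open>s\<close>, induction along the chain shows that the positions have equal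
  transforms: their difference times the characteristic polynomial is 0, and stability excludes
  zeros with \<open>Re s \<ge> 0\<close>. Equality of the error transforms follows, and uniqueness
  of Laplace transforms carries it to the time domain.\<close>

lemma chain_response_error_unique:
  assumes stab: "stabilizing_pid kP kI kD h"
    and r: "chain_response (pid kP kI kD) h N d x u e"
    and r': "chain_response (pid kP kI kD) h N d x' u' e'"
    and i: "i \<in> {1..N}"
  shows "AE t in lborel. e i t = e' i t"
proof -
  let ?K = "pid kP kI kD"
  obtain \<sigma> where \<sigma>: "\<sigma> \<ge> 0" "\<forall>s. Re s > \<sigma> \<longrightarrow>
        (\<forall>i\<in>{0..N}. laplace_converges (d i) s \<and> laplace_converges (x i) s \<and> laplace_converges (u i) s) \<and>
        (\<forall>i\<in>{1..N}. laplace_converges (e i) s) \<and>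
        (\<forall>i\<in>{0..N}. s\<^sup>2 * laplace (x i) s = laplace (u i) s + laplace (d i) s) \<and>
        (\<forall>i\<in>{1..N}. laplace (e i) s =
           laplace (x (i - 1)) s - laplace (x i) s - of_real h * s * laplace (x i) s) \<and>
        laplace (u 0) s = 0 \<and> (\<forall>i\<in>{1..N}. laplace (u i) s = ?K s * laplace (e i) s)"
    using r unfolding chain_response_def by blast
  obtain \<sigma>' where \<sigma>': "\<sigma>' \<ge> 0" "\<forall>s. Re s > \<sigma>' \<longrightarrow>
        (\<forall>i\<in>{0..N}. laplace_converges (d i) s \<and> laplace_converges (x' i) s \<and> laplace_converges (u' i) s) \<and>
        (\<forall>i\<in>{1..N}. laplace_converges (e' i) s) \<and>
        (\<forall>i\<in>{0..N}. s\<^sup>2 * laplace (x' i) s = laplace (u' i) s + laplace (d i) s) \<and>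
        (\<forall>i\<in>{1..N}. laplace (e' i) s =
           laplace (x' (i - 1)) s - laplace (x' i) s - of_real h * s * laplace (x' i) s) \<and>
        laplace (u' 0) s = 0 \<and> (\<forall>i\<in>{1..N}. laplace (u' i) s = ?K s * laplace (e' i) s)"
    using r' unfolding chain_response_def by blast
  have x: "laplace (x j) s = laplace (x' j) s" if s: "Re s > max \<sigma> \<sigma>'" and "j \<le> N" for s j
    using \<open>j \<le> N\<close>
  proof (induction j)
    case 0
    have "s \<noteq> 0"
      using s \<sigma>(1) by auto
    moreover have "s\<^sup>2 * laplace (x 0) s = s\<^sup>2 * laplace (x' 0) s"
      using \<sigma>(2) \<sigma>'(2) s by simp
    ultimately show ?case
      by simp
  next
    case (Suc j)
    define P where "P = laplace (x j) s"
    define X where "X = laplace (x (Suc j)) s"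
    define X' where "X' = laplace (x' (Suc j)) s"
    define D where "D = laplace (d (Suc j)) s"
    have s0: "s \<noteq> 0" "\<not> Re s < 0"
      using s \<sigma>(1) by auto
    have mem: "Suc j \<in> {0..N}" "Suc j \<in> {1..N}"
      using Suc.prems by auto
    have P': "laplace (x' j) s = P"
      using Suc by (simp add: P_def)
    have X: "s\<^sup>2 * X = ?K s * (P - X - of_real h * s * X) + D"
      using \<sigma>(2) s mem by (simp add: P_def X_def D_def)
    have X': "s\<^sup>2 * X' = ?K s * (P - X' - of_real h * s * X') + D"
      using \<sigma>'(2) s mem by (simp add: P'[symmetric] X'_def D_def)
    have "poly (pid_char_poly kP kI kD h) s * (X - X') =
        s * (s\<^sup>2 * X + (1 + of_real h * s) * ?K s * X - (s\<^sup>2 * X' + (1 + of_real h * s) * ?K s * X'))"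
      by (simp add: poly_pid_char_poly[OF s0(1)] power2_eq_square power3_eq_cube algebra_simps)
    also have "\<dots> = 0"
      unfolding X X' by (simp add: algebra_simps)
    finally show ?case
      using stab s0(2) by (auto simp: stabilizing_pid_def X_def X'_def)
  qed
  show ?thesis
  proof (rule laplace_unique[where \<sigma> = "max \<sigma> \<sigma>'"])
    show "signal (e i)" "signal (e' i)"
      using r r' i by (auto simp: chain_response_def)
    fix s assume s: "Re s > max \<sigma> \<sigma>'"
    show "laplace_converges (e i) s" "laplace_converges (e' i) s"
      using \<sigma>(2) \<sigma>'(2) s i by simp_all
    have "i \<le> N" "i - 1 \<le> N"
      using i by auto
    then have "laplace (x i) s = laplace (x' i) s" "laplace (x (i - 1)) s = laplace (x' (i - 1)) s"
      using x[OF s] by blast+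
    then show "laplace (e i) s = laplace (e' i) s"
      using \<sigma>(2) \<sigma>'(2) s i by simp
  qed
qed

section \<open>The controller\<close>

lemma stabilizing_pid_chosen_gains: "stabilizing_pid (3/4) (1/4) 0 3"
  unfolding stabilizing_pid_def
proof (intro allI impI)
  fix s :: complex
  assume "poly (pid_char_poly (3/4) (1/4) 0 3) s = 0"
  also have "poly (pid_char_poly (3/4) (1/4) 0 3) s = (s + 1)\<^sup>2 * (s + 1/4)"
    by (simp add: pid_char_poly_def poly_monom power2_eq_square power3_eq_cube field_simps)
  finally have "s + 1 = 0 \<or> s + 1/4 = 0"
    by simp
  then have "s = -1 \<or> s = - (1/4)"
    by (simp add: eq_neg_iff_add_eq_0)
  then show "Re s < 0"
    by auto
qed

text \<open>The admissible frequencies \<open>p \<omega> > 0\<close>,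
  \<open>\<omega> \<noteq> 0\<close> do not form a closed set. The continuous extension
  \<open>B\<close> of the headway bound is therefore maximised over the compact set
  \<open>S\<close>, and the maximiser is then shown to be admissible.\<close>

lemma sufficient_headway_chosen_gains: "sufficient_headway (pid (3/4) (1/4) 0) 3"
proof -
  let ?K = "pid (3/4) (1/4) 0"
  define p where "p \<omega> = 1 + 9 * \<omega>\<^sup>2 - 6 * (\<omega>\<^sup>2)\<^sup>2" for \<omega> :: real
  define B where "B \<omega> = (sqrt (24 * \<omega>\<^sup>2 * p \<omega>) + 4 * \<omega>\<^sup>2) / (9 * \<omega>\<^sup>2 + 1)" for \<omega>
  have pos: "9 * \<omega>\<^sup>2 + 1 > 0" for \<omega> :: real
    by (simp add: add_nonneg_pos)
  have inv: "1 / ?K (\<i> * of_real \<omega>) = Complex (12 * \<omega>\<^sup>2 / (9 * \<omega>\<^sup>2 + 1)) (4 * \<omega> / (9 * \<omega>\<^sup>2 + 1))"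
    and nz: "?K (\<i> * of_real \<omega>) \<noteq> 0" if "\<omega> \<noteq> 0" for \<omega>
  proof -
    have K: "?K (\<i> * of_real \<omega>) = Complex (3/4) (- 1 / (4 * \<omega>))"
      using that by (simp add: pid_def complex_eq_iff Re_divide Im_divide power2_eq_square)
    show "?K (\<i> * of_real \<omega>) \<noteq> 0"
      by (simp add: K complex_eq_iff)
    have "Complex (12 * \<omega>\<^sup>2 / (9 * \<omega>\<^sup>2 + 1)) (4 * \<omega> / (9 * \<omega>\<^sup>2 + 1)) * Complex (3/4) (- 1 / (4 * \<omega>)) = 1"
      using that pos[of \<omega>] by (simp add: complex_eq_iff field_simps power2_eq_square)
    then show "1 / ?K (\<i> * of_real \<omega>) = Complex (12 * \<omega>\<^sup>2 / (9 * \<omega>\<^sup>2 + 1)) (4 * \<omega> / (9 * \<omega>\<^sup>2 + 1))"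
      unfolding K by (metis K \<open>?K (\<i> * of_real \<omega>) \<noteq> 0\<close> nonzero_eq_divide_eq)
  qed
  have K_R: "K_R ?K \<omega> = 12 * \<omega>\<^sup>2 / (9 * \<omega>\<^sup>2 + 1)" and K_J: "K_J ?K \<omega> = 4 * \<omega> / (9 * \<omega>\<^sup>2 + 1)"
    if "\<omega> \<noteq> 0" for \<omega>
  proof -
    have c: "1 / cnj (?K (\<i> * of_real \<omega>)) = cnj (1 / ?K (\<i> * of_real \<omega>))"
      by simp
    have "Re (1 / 2 * (w + cnj w)) = Re w" "Re (1 / (2 * \<i>) * (w - cnj w)) = Im w" for w
      by (simp_all add: Re_divide)
    note parts = this
    show "K_R ?K \<omega> = 12 * \<omega>\<^sup>2 / (9 * \<omega>\<^sup>2 + 1)"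
      unfolding K_R_def c parts inv[OF that] by simp
    show "K_J ?K \<omega> = 4 * \<omega> / (9 * \<omega>\<^sup>2 + 1)"
      unfolding K_J_def c parts inv[OF that] by simp
  qed
  have arg: "sqrt_arg ?K \<omega> = 24 * \<omega>\<^sup>2 * p \<omega> / (9 * \<omega>\<^sup>2 + 1)\<^sup>2" if "\<omega> \<noteq> 0" for \<omega>
    using pos[of \<omega>] by (simp add: sqrt_arg_def K_R[OF that] p_def field_simps power2_eq_square)
  have freqs: "\<omega> \<in> headway_freqs ?K \<longleftrightarrow> \<omega> \<noteq> 0 \<and> p \<omega> > 0" for \<omega>
    using pos[of \<omega>] by (auto simp: headway_freqs_def nz arg zero_less_divide_iff zero_less_mult_iff)
  have bound: "headway_bound ?K \<omega> = B \<omega>" if "\<omega> \<noteq> 0" for \<omega>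
    using pos[of \<omega>] by (simp add: headway_bound_def arg[OF that] K_J[OF that] B_def real_sqrt_divide
        add_divide_distrib power2_eq_square)
  define S where "S = {\<omega>. p \<omega> \<ge> 0}"
  have "closed S"
    unfolding S_def p_def by (intro closed_Collect_le continuous_intros)
  moreover have "S \<subseteq> {-2..2}"
  proof
    fix \<omega> assume "\<omega> \<in> S"
    have "\<omega>\<^sup>2 \<le> 2\<^sup>2"
    proof (rule ccontr)
      assume "\<not> \<omega>\<^sup>2 \<le> 2\<^sup>2"
      then have "\<omega>\<^sup>2 > 4"
        by simp
      then have "\<omega>\<^sup>2 * \<omega>\<^sup>2 > 4 * \<omega>\<^sup>2"
        by (intro mult_strict_right_mono) auto
      then show False
        using \<open>\<omega> \<in> S\<close> \<open>\<omega>\<^sup>2 > 4\<close> by (simp add: S_def p_def power2_eq_square[of "\<omega>\<^sup>2"])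
    qed
    then show "\<omega> \<in> {-2..2}"
      using abs_le_square_iff[of \<omega> 2] by auto
  qed
  ultimately have "compact S"
    by (meson bounded_closed_interval bounded_subset compact_eq_bounded_closed)
  moreover have half: "1 / 2 \<in> S" "p (1 / 2) > 0"
    by (simp_all add: S_def p_def power2_eq_square)
  moreover have "continuous_on S B"
    unfolding B_def p_def by (intro continuous_intros) (use pos in \<open>auto simp: less_le\<close>)
  ultimately obtain m where m: "m \<in> S" "\<And>y. y \<in> S \<Longrightarrow> B y \<le> B m"
    using continuous_attains_sup[of S B] by auto
  \<comment> \<open>A test frequency: where \<open>p\<close> vanishes \<open>B\<close> is at most
    4/9, and at frequency 0 it is 0, so neither kind of point can be the maximiser.\<close>
  have "B (1 / 2) > 4 / 9"
  proof -
    have "sqrt (24 * (1/2)\<^sup>2 * p (1/2)) \<ge> 4"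
      by (rule real_le_rsqrt) (simp add: p_def power2_eq_square)
    then show ?thesis
      by (simp add: B_def power2_eq_square)
  qed
  then have Bm: "B m > 4 / 9"
    using m(2)[OF half(1)] by linarith
  have "m \<noteq> 0"
    using Bm by (auto simp: B_def)
  moreover have "p m > 0"
  proof (rule ccontr)
    assume "\<not> p m > 0"
    then have "p m = 0"
      using m(1) by (simp add: S_def)
    then have "B m = 4 * m\<^sup>2 / (9 * m\<^sup>2 + 1)"
      by (simp add: B_def)
    also have "\<dots> \<le> 4 / 9"
      using pos[of m] by (simp add: field_simps)
    finally show False
      using Bm by simp
  qed
  ultimately have freq: "m \<in> headway_freqs ?K"
    by (simp add: freqs)
  have "B m < 3"
  proof -
    \<comment> \<open>Clearing the denominator, \<open>B m < 3\<close> says that the square root is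
      below \<open>3 * (9 * m^2 + 1) - 4 * m^2 = 23 * m^2 + 3\<close>.\<close>
    have "24 * m\<^sup>2 * p m \<le> 24 * m\<^sup>2 * (1 + 9 * m\<^sup>2)"
      by (intro mult_left_mono) (auto simp: p_def)
    also have "\<dots> < 24 * m\<^sup>2 * (1 + 9 * m\<^sup>2) + (313 * (m\<^sup>2)\<^sup>2 + 114 * m\<^sup>2 + 9)"
      by (simp add: add_nonneg_pos)
    also have "\<dots> = (23 * m\<^sup>2 + 3)\<^sup>2"
      by (simp add: power2_eq_square algebra_simps)
    finally have "sqrt (24 * m\<^sup>2 * p m) < 23 * m\<^sup>2 + 3"
      by (rule real_less_lsqrt[rotated]) simp
    then show ?thesis
      using pos[of m] by (simp add: B_def field_simps)
  qed
  moreover have "is_arg_max (headway_bound ?K) (\<lambda>\<omega>. \<omega> \<in> headway_freqs ?K) m"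
    unfolding is_arg_max_def
  proof (intro conjI freq notI)
    assume "\<exists>y. y \<in> headway_freqs ?K \<and> headway_bound ?K m < headway_bound ?K y"
    then obtain y where "y \<in> headway_freqs ?K" "headway_bound ?K m < headway_bound ?K y"
      by blast
    then have "B m < B y" "y \<in> S"
      using \<open>m \<noteq> 0\<close> by (auto simp: freqs bound S_def)
    then show False
      using m(2)[of y] by simp
  qed
  ultimately show ?thesis
    using bound[OF \<open>m \<noteq> 0\<close>] unfolding sufficient_headway_def by auto
qed

section \<open>String stability\<close>

text \<open>The loops carry no absolute positions; these are recovered as double integrals of the
  accelerations, and the control is the acceleration minus the disturbance. Primitives become
  multiplication by \<open>s\<close>, so the error equation is obtained multiplied by
  \<open>s^2\<close>, which cancels far to the right.\<close>

lemma platoon_chain_response: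
  assumes d: "\<And>i. exp_L2 (d i)" and f0: "f 0 = d 0"
    and step: "\<And>i. follower (f i) (d (Suc i)) (z (Suc i)) (e (Suc i)) (q (Suc i)) (f (Suc i))"
  shows "chain_response (pid (3/4) (1/4) 0) 3 N d
    (\<lambda>i. running_integral (running_integral (f i))) (\<lambda>i t. f i t - d i t) e"
proof -
  let ?x = "\<lambda>i. running_integral (running_integral (f i))"
  have L2: "exp_L2 (f i)" "exp_L2 (?x i)" "exp_L2 (\<lambda>t. f i t - d i t)" for i
  proof -
    show "exp_L2 (f i)"
      using follower_exp_L2(4)[OF step] d f0 by (cases i) auto
    then show "exp_L2 (?x i)" "exp_L2 (\<lambda>t. f i t - d i t)"
      using d by (auto intro: exp_L2_running_integral exp_L2_diff)
  qed
  have far: "\<forall>\<^sub>F s in right_half_planes. Re s > 0"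
    by (auto simp: eventually_filtercomap_at_top_dense)
  note conv = exp_L2_laplace_converges
  have x: "\<forall>\<^sub>F s in right_half_planes. s\<^sup>2 * laplace (?x i) s = laplace (f i) s" for i
    using laplace_running_integral[OF L2(1)[of i]]
      laplace_running_integral[OF exp_L2_running_integral[OF L2(1)[of i]]]
    by eventually_elim (simp add: power2_eq_square mult.assoc)
  have u: "\<forall>\<^sub>F s in right_half_planes. laplace (\<lambda>t. f i t - d i t) s = laplace (f i) s - laplace (d i) s" for i
    using conv[OF L2(1)[of i]] conv[OF d[of i]] by eventually_elim (rule laplace_diff)
  show ?thesis
  proof (rule chain_responseI)
    show "signal (?x i) \<and> signal (\<lambda>t. f i t - d i t)" for i
      using L2(2,3)[of i] by (auto intro: exp_L2_signal)
    show "\<forall>\<^sub>F s in right_half_planes. laplace_converges (d i) s \<and> laplace_converges (?x i) s \<and>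
        laplace_converges (\<lambda>t. f i t - d i t) s \<and>
        s\<^sup>2 * laplace (?x i) s = laplace (\<lambda>t. f i t - d i t) s + laplace (d i) s" for i
      using conv[OF d[of i]] conv[OF L2(2)[of i]] conv[OF L2(3)[of i]] x[of i] u[of i]
      by eventually_elim simp
    show "\<forall>\<^sub>F s in right_half_planes. laplace (\<lambda>t. f 0 t - d 0 t) s = 0"
      by (simp add: f0 laplace_def)
    fix i assume "i \<in> {1..N}"
    then obtain j where i: "i = Suc j"
      by (cases i) auto
    note F = step[of j, folded i]
    have P: "primitive (z i) (e i)" "primitive (e i) (\<lambda>t. q i t - 3 * f i t)"
      "primitive (q i) (\<lambda>t. f j t - f i t)"
      and fi: "f i = (\<lambda>t. d i t + 3 / 4 * e i t + 1 / 4 * z i t)"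
      using F unfolding follower_def by blast+
    show "signal (e i)"
      using follower_exp_L2(2)[OF F] by (rule exp_L2_signal)
    show "\<forall>\<^sub>F s in right_half_planes. laplace_converges (e i) s \<and>
        laplace (e i) s = laplace (?x (i - 1)) s - laplace (?x i) s - of_real 3 * s * laplace (?x i) s \<and>
        laplace (\<lambda>t. f i t - d i t) s = pid (3/4) (1/4) 0 s * laplace (e i) s"
      using far conv[OF follower_exp_L2(1)[OF F]] conv[OF follower_exp_L2(2)[OF F]]
        conv[OF follower_exp_L2(3)[OF F]] conv[OF L2(1)[of i]] conv[OF L2(1)[of j]]
        x[of i] x[of j] P[THEN primitive_laplace]
    proof eventually_elim
      case (elim s)
      then have s: "s \<noteq> 0"
        by auto
      have q: "s * laplace (q i) s = s\<^sup>2 * laplace (?x j) s - s\<^sup>2 * laplace (?x i) s"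
        using elim by (simp add: laplace_diff)
      have e: "s * laplace (e i) s = laplace (q i) s - 3 * (s\<^sup>2 * laplace (?x i) s)"
        using elim by (simp add: laplace_diff laplace_cmult laplace_cmult_converges)
      have "s * (s * laplace (e i) s) =
          s * (s * (laplace (?x j) s - laplace (?x i) s - 3 * s * laplace (?x i) s))"
        unfolding e right_diff_distrib q by (simp add: power2_eq_square algebra_simps)
      then have "laplace (e i) s = laplace (?x j) s - laplace (?x i) s - 3 * s * laplace (?x i) s"
        using s by simp
      moreover have "laplace (\<lambda>t. f i t - d i t) s = pid (3/4) (1/4) 0 s * laplace (e i) s"
      proof -
        have "(\<lambda>t. f i t - d i t) = (\<lambda>t. 3 / 4 * e i t + 1 / 4 * z i t)"
          by (simp add: fi)
        then have "laplace (\<lambda>t. f i t - d i t) s = 3 / 4 * laplace (e i) s + 1 / 4 * laplace (z i) s"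
          using elim by (simp only: laplace_add laplace_cmult laplace_cmult_converges) simp
        also have "\<dots> = pid (3/4) (1/4) 0 s * laplace (e i) s"
          \<comment> \<open>The fact used is \<open>s * laplace (z i) s = laplace (e i) s\<close>,
            which turns the integral state into the term \<open>1 / (4 s)\<close> of the
            controller.\<close>
          using elim(9)[symmetric] s by (simp add: pid_def field_simps)
        finally show ?thesis .
      qed
      ultimately show ?case
        using elim i by simp
    qed
  qed
qed

section \<open>From energy bounds to the string-stability gain\<close>

lemma L2_l2_norm_le:
  assumes "c \<ge> 0" "(\<Sum>i\<in>I. LINT t|lborel. (v i t)\<^sup>2) \<le> c\<^sup>2 * (\<Sum>i\<in>J. LINT t|lborel. (w i t)\<^sup>2)"
  shows "L2_l2_norm I v \<le> c * L2_l2_norm J w"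
proof -
  have "L2_l2_norm I v \<le> sqrt (c\<^sup>2 * (\<Sum>i\<in>J. LINT t|lborel. (w i t)\<^sup>2))"
    unfolding L2_l2_norm_def by (rule real_sqrt_le_mono[OF assms(2)])
  then show ?thesis
    using \<open>c \<ge> 0\<close> by (simp add: L2_l2_norm_def real_sqrt_mult)
qed

text \<open>The energy inequality gives the factor \<open>14 * 16 / 3\<close>, which is below
  \<open>9^2\<close>; this is the origin of the gain 9. Each error energy is dominated by the sum,
  so the horizon can tend to infinity.\<close>

lemma platoon_gain:
  assumes d: "\<And>i. signal (d i)" "\<And>i. finite_L2 (d i)" and f0: "f 0 = d 0"
    and step: "\<And>i. follower (f i) (d (Suc i)) (z (Suc i)) (e (Suc i)) (q (Suc i)) (f (Suc i))"
  shows "i \<in> {1..N} \<Longrightarrow> finite_L2 (e i)"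
    and "(\<Sum>i\<in>{1..N}. LINT t|lborel. (e i t)\<^sup>2) \<le> 9\<^sup>2 * (\<Sum>i\<in>{0..N}. LINT t|lborel. (d i t)\<^sup>2)"
proof -
  have dL2: "exp_L2 (d i)" for i
    using d by (intro exp_L2_finite_L2)
  have eL2: "exp_L2 (e i)" if "i \<in> {1..N}" for i
    using that follower_exp_L2(2)[OF step] by (cases i) auto
  define E where "E i n = running_integral (\<lambda>t. e i t * e i t) (real n)" for i n
  define D where "D = (\<Sum>i\<in>{0..N}. LINT t|lborel. (d i t)\<^sup>2)"
  have E_nonneg: "E i n \<ge> 0" for i n
    unfolding E_def running_integral_def set_lebesgue_integral_def by (rule integral_nonneg_AE) auto
  have D_nonneg: "D \<ge> 0"
    unfolding D_def by (intro sum_nonneg integral_nonneg_AE) auto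
  have d_le: "running_integral (\<lambda>t. d i t * d i t) T \<le> (LINT t|lborel. (d i t)\<^sup>2)" for i T
    unfolding running_integral_def set_lebesgue_integral_def
  proof (rule integral_mono)
    show "integrable lborel (\<lambda>t. indicator {0..T} t *\<^sub>R (d i t * d i t))"
      using exp_L2_set_integrable_mult[OF dL2 dL2] unfolding set_integrable_def .
    show "integrable lborel (\<lambda>t. (d i t)\<^sup>2)"
      using d(2) by (simp add: finite_L2_def)
  qed (auto simp: indicator_def power2_eq_square)
  have sum_le: "(\<Sum>i\<in>{1..N}. E i n) \<le> 9\<^sup>2 * D" for n
  proof -
    have "3 / 16 * (\<Sum>i\<in>{1..N}. E i n) \<le> 14 * (\<Sum>i\<in>{0..N}. running_integral (\<lambda>t. d i t * d i t) (real n))"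
      unfolding E_def by (rule platoon_energy[of f d, OF f0 step])
    also have "\<dots> \<le> 14 * D"
      unfolding D_def by (intro mult_left_mono sum_mono d_le) auto
    finally show ?thesis
      using D_nonneg by simp
  qed
  have E_le: "E i n \<le> 9\<^sup>2 * D" if "i \<in> {1..N}" for i n
    using member_le_sum[OF that, of "\<lambda>i. E i n"] E_nonneg sum_le[of n] by fastforce
  show "finite_L2 (e i)" if "i \<in> {1..N}" for i
    by (rule finite_L2_if_truncated_bounded(1)[OF eL2[OF that] E_le[OF that, unfolded E_def]])
  have "(\<lambda>n. \<Sum>i\<in>{1..N}. E i n) \<longlonglongrightarrow> (\<Sum>i\<in>{1..N}. LINT t|lborel. (e i t)\<^sup>2)"
    unfolding E_def
    by (intro tendsto_sum finite_L2_if_truncated_bounded(2)[OF eL2 E_le[unfolded E_def]])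
  then show "(\<Sum>i\<in>{1..N}. LINT t|lborel. (e i t)\<^sup>2) \<le> 9\<^sup>2 * (\<Sum>i\<in>{0..N}. LINT t|lborel. (d i t)\<^sup>2)"
    unfolding D_def[symmetric] by (rule LIMSEQ_le_const2) (use sum_le in blast)
qed

lemma chain_response_cong:
  assumes "\<And>i. i \<le> N \<Longrightarrow> d i = d' i"
  shows "chain_response K h N d x u e \<longleftrightarrow> chain_response K h N d' x u e"
  unfolding chain_response_def using assms by simp

lemma string_stable_chosen_gains: "L2_l2_string_stable (pid (3/4) (1/4) 0) 3"
  unfolding L2_l2_string_stable_def
proof (intro exI[of _ 9] allI impI)
  let ?K = "pid (3/4) (1/4) 0"
  fix N and d :: "nat \<Rightarrow> real \<Rightarrow> real"
  assume d: "\<forall>i\<in>{0..N}. signal (d i) \<and> finite_L2 (d i)"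
  \<comment> \<open>Zero disturbances beyond vehicle \<open>N\<close> extend the data to an infinite
    chain, leaving the first \<open>N + 1\<close> vehicles as they were.\<close>
  define d' where "d' i = (if i \<le> N then d i else (\<lambda>_. 0))" for i
  have d': "signal (d' i)" "finite_L2 (d' i)" for i
    using d by (auto simp: d'_def signal_def finite_L2_def)
  obtain z e q f where f0: "f 0 = d' 0"
    and step: "\<And>i. follower (f i) (d' (Suc i)) (z (Suc i)) (e (Suc i)) (q (Suc i)) (f (Suc i))"
    using platoon_exists[of d'] exp_L2_finite_L2[OF d'] by blast
  have cong: "chain_response ?K 3 N d' x u e \<longleftrightarrow> chain_response ?K 3 N d x u e" for x u e
    by (rule chain_response_cong) (simp add: d'_def)
  note resp = platoon_chain_response[OF exp_L2_finite_L2[OF d'] f0 step, of N]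
  note gain = platoon_gain[OF d' f0 step]
  show "(\<exists>x u e. chain_response ?K 3 N d x u e) \<and>
    (\<forall>x u e. chain_response ?K 3 N d x u e \<longrightarrow>
      (\<forall>i\<in>{1..N}. finite_L2 (e i)) \<and> L2_l2_norm {1..N} e \<le> 9 * L2_l2_norm {0..N} d)"
  proof (intro conjI allI impI ballI)
    show "\<exists>x u e. chain_response ?K 3 N d x u e"
      using resp cong by blast
  next
    fix x u e'
    assume "chain_response ?K 3 N d x u e'"
    then have r: "chain_response ?K 3 N d' x u e'"
      by (simp add: cong)
    \<comment> \<open>The arbitrary response is compared with the constructed one; the energy only
      sees errors up to null sets.\<close>
    have AE: "AE t in lborel. (e' i t)\<^sup>2 = (e i t)\<^sup>2" if "i \<in> {1..N}" for i
      using chain_response_error_unique[OF stabilizing_pid_chosen_gains r resp that]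
      by eventually_elim simp
    have meas: "(\<lambda>t. (e' i t)\<^sup>2) \<in> borel_measurable lborel" "(\<lambda>t. (e i t)\<^sup>2) \<in> borel_measurable lborel"
      if "i \<in> {1..N}" for i
    proof -
      have [measurable]: "e' i \<in> borel_measurable borel" "e i \<in> borel_measurable borel"
        using r resp that unfolding chain_response_def signal_def by blast+
      show "(\<lambda>t. (e' i t)\<^sup>2) \<in> borel_measurable lborel" "(\<lambda>t. (e i t)\<^sup>2) \<in> borel_measurable lborel"
        by measurable
    qed
    show "finite_L2 (e' i)" if "i \<in> {1..N}" for i
      using gain(1)[OF that] integrable_cong_AE[OF meas[OF that] AE[OF that]] by (simp add: finite_L2_def)
    have "(\<Sum>i\<in>{1..N}. LINT t|lborel. (e' i t)\<^sup>2) = (\<Sum>i\<in>{1..N}. LINT t|lborel. (e i t)\<^sup>2)"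
      by (intro sum.cong refl integral_cong_AE meas AE)
    also have "\<dots> \<le> 9\<^sup>2 * (\<Sum>i\<in>{0..N}. LINT t|lborel. (d' i t)\<^sup>2)"
      by (rule gain(2))
    also have "(\<Sum>i\<in>{0..N}. LINT t|lborel. (d' i t)\<^sup>2) = (\<Sum>i\<in>{0..N}. LINT t|lborel. (d i t)\<^sup>2)"
      by (intro sum.cong refl) (simp add: d'_def)
    finally show "L2_l2_norm {1..N} e' \<le> 9 * L2_l2_norm {0..N} d"
      by (intro L2_l2_norm_le) auto
  qed
qed

theorem theorem2:
  "\<exists>kP kI kD h :: real.
     kI \<noteq> 0 \<and> h > 0 \<and>
     stabilizing_pid kP kI kD h \<and>
     sufficient_headway (pid kP kI kD) h \<and>
     L2_l2_string_stable (pid kP kI kD) h"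
  using stabilizing_pid_chosen_gains sufficient_headway_chosen_gains string_stable_chosen_gains
  by (intro exI[of _ "3/4"] exI[of _ "1/4"] exI[of _ 0] exI[of _ 3]) simp

end
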